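(* The class of acylindrically hyperbolic groups is closed under taking $s$-normal subgroups; that is, if $G$ is an acylindrically hyperbolic group and $H\le G$ is a subgroup that is $s$-normal in $G$, then $H$ is acylindrically hyperbolic.
   Context: A subgroup $H\le G$ is $s$-normal in $G$ if $|H^g\cap H|=\infty$ for every $g\in G$, where $H^g=g^{-1}Hg$. All actions on metric spaces are by isometries. A metric space is hyperbolic if it is geodesic and for some $\delta\ge0$ every side of every geodesic triangle lies in the union of the $\delta$-neighborhoods of the other two sides; it is not assumed proper. An action of $G$ on $(S,d)$ is acylindrical if for every $\varepsilon>0$ there exist $R,N>0$ such that for all $x,y\in S$ with $d(x,y)\ge R$ there are at most $N$ elements $g\in G$ with $d(x,gx)\le\varepsilon$ and $d(y,gy)\le\varepsilon$. An action of $G$ on a hyperbolic space $S$ is elementary if the limit set of $G$ on the Gromov boundary $\partial S$ (the set of accumulation points in $\partial S$ of any orbit) has at most $2$ points, and non-elementary otherwise. A group is acylindrically hyperbolic if it admits a non-elementary acylindrical action on a hyperbolic space. *)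

theory Defs
  imports "HOL-Algebra.Group_Action" "HOL-Analysis.Abstract_Metric_Spaces"
begin

section \<open>s-normal subgroups\<close>

definition s_normal :: "'g set \<Rightarrow> ('g, 'm) monoid_scheme \<Rightarrow> bool" where
  "s_normal H G \<longleftrightarrow>
     subgroup H G \<and>
     (\<forall>g\<in>carrier G. infinite ((inv\<^bsub>G\<^esub> g <#\<^bsub>G\<^esub> H #>\<^bsub>G\<^esub> g) \<inter> H))"


section \<open>Hyperbolic metric spaces\<close>

text \<open>A metric space is a carrier set \<open>M\<close> with a distance function \<open>d\<close>, as in the library
  locale \<^locale>\<open>Metric_space\<close>. No properness or completeness is assumed.\<close>

definition geodesic_segment ::
  "'s set \<Rightarrow> ('s \<Rightarrow> 's \<Rightarrow> real) \<Rightarrow> 's \<Rightarrow> 's \<Rightarrow> 's set \<Rightarrow> bool" where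
  "geodesic_segment M d x y A \<longleftrightarrow>
     (\<exists>\<gamma>. \<gamma> ` {0..d x y} = A \<and> A \<subseteq> M \<and> \<gamma> 0 = x \<and> \<gamma> (d x y) = y \<and>
          (\<forall>s\<in>{0..d x y}. \<forall>t\<in>{0..d x y}. d (\<gamma> s) (\<gamma> t) = \<bar>s - t\<bar>))"

definition nbhd :: "'s set \<Rightarrow> ('s \<Rightarrow> 's \<Rightarrow> real) \<Rightarrow> real \<Rightarrow> 's set \<Rightarrow> 's set" where
  "nbhd M d \<delta> A = {p\<in>M. \<exists>q\<in>A. d p q \<le> \<delta>}"

definition hyperbolic_space :: "'s set \<Rightarrow> ('s \<Rightarrow> 's \<Rightarrow> real) \<Rightarrow> bool" where
  "hyperbolic_space M d \<longleftrightarrow>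
     Metric_space M d \<and>
     (\<forall>x\<in>M. \<forall>y\<in>M. \<exists>A. geodesic_segment M d x y A) \<and>
     (\<exists>\<delta>\<ge>0. \<forall>x\<in>M. \<forall>y\<in>M. \<forall>z\<in>M. \<forall>A B C.
        geodesic_segment M d x y A \<longrightarrow> geodesic_segment M d y z B \<longrightarrow>
        geodesic_segment M d z x C \<longrightarrow>
          A \<subseteq> nbhd M d \<delta> B \<union> nbhd M d \<delta> C \<and>
          B \<subseteq> nbhd M d \<delta> C \<union> nbhd M d \<delta> A \<and>
          C \<subseteq> nbhd M d \<delta> A \<union> nbhd M d \<delta> B)"


section \<open>The Gromov boundary\<close>

definition gromov_product :: "('s \<Rightarrow> 's \<Rightarrow> real) \<Rightarrow> 's \<Rightarrow> 's \<Rightarrow> 's \<Rightarrow> real" where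
  "gromov_product d p x y = (d x p + d y p - d x y) / 2"

text \<open>As the space need not be proper, the boundary is defined by sequences rather than by
  geodesic rays. The Gromov products are required to tend to infinity with respect to every base
  point; changing the base point alters them by a bounded amount only.\<close>

definition gromov_products_diverge ::
  "'s set \<Rightarrow> ('s \<Rightarrow> 's \<Rightarrow> real) \<Rightarrow> (nat \<Rightarrow> 's) \<Rightarrow> (nat \<Rightarrow> 's) \<Rightarrow> bool" where
  "gromov_products_diverge M d u v \<longleftrightarrow>
     (\<forall>p\<in>M. filterlim (\<lambda>(i, j). gromov_product d p (u i) (v j)) at_top
               (sequentially \<times>\<^sub>F sequentially))"

definition converging_at_infinity ::
  "'s set \<Rightarrow> ('s \<Rightarrow> 's \<Rightarrow> real) \<Rightarrow> (nat \<Rightarrow> 's) set" where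
  "converging_at_infinity M d = {u. range u \<subseteq> M \<and> gromov_products_diverge M d u u}"

definition boundary_rel ::
  "'s set \<Rightarrow> ('s \<Rightarrow> 's \<Rightarrow> real) \<Rightarrow> ((nat \<Rightarrow> 's) \<times> (nat \<Rightarrow> 's)) set" where
  "boundary_rel M d =
     {(u, v). u \<in> converging_at_infinity M d \<and> v \<in> converging_at_infinity M d \<and>
              gromov_products_diverge M d u v}"

definition gromov_boundary ::
  "'s set \<Rightarrow> ('s \<Rightarrow> 's \<Rightarrow> real) \<Rightarrow> (nat \<Rightarrow> 's) set set" where
  "gromov_boundary M d = converging_at_infinity M d // boundary_rel M d"

text \<open>A sequence of points of \<open>M\<close> converges to the boundary point \<open>\<xi>\<close> exactly if it is a
  member of the equivalence class \<open>\<xi>\<close>; a boundary point is never itself an orbit point.\<close>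

definition accumulation_points ::
  "'s set \<Rightarrow> ('s \<Rightarrow> 's \<Rightarrow> real) \<Rightarrow> 's set \<Rightarrow> (nat \<Rightarrow> 's) set set" where
  "accumulation_points M d A = {\<xi> \<in> gromov_boundary M d. \<exists>u\<in>\<xi>. range u \<subseteq> A}"


section \<open>Actions\<close>

definition isometric_action ::
  "('g, 'm) monoid_scheme \<Rightarrow> 's set \<Rightarrow> ('s \<Rightarrow> 's \<Rightarrow> real) \<Rightarrow> ('g \<Rightarrow> 's \<Rightarrow> 's) \<Rightarrow> bool" where
  "isometric_action G M d \<phi> \<longleftrightarrow>
     group_action G M \<phi> \<and>
     (\<forall>g\<in>carrier G. \<forall>x\<in>M. \<forall>y\<in>M. d (\<phi> g x) (\<phi> g y) = d x y)"

definition acylindrical_action ::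
  "('g, 'm) monoid_scheme \<Rightarrow> 's set \<Rightarrow> ('s \<Rightarrow> 's \<Rightarrow> real) \<Rightarrow> ('g \<Rightarrow> 's \<Rightarrow> 's) \<Rightarrow> bool" where
  "acylindrical_action G M d \<phi> \<longleftrightarrow>
     isometric_action G M d \<phi> \<and>
     (\<forall>\<epsilon>>0. \<exists>R>0. \<exists>N>(0::nat). \<forall>x\<in>M. \<forall>y\<in>M. d x y \<ge> R \<longrightarrow>
        finite {g\<in>carrier G. d x (\<phi> g x) \<le> \<epsilon> \<and> d y (\<phi> g y) \<le> \<epsilon>} \<and>
        card {g\<in>carrier G. d x (\<phi> g x) \<le> \<epsilon> \<and> d y (\<phi> g y) \<le> \<epsilon>} \<le> N)"

text \<open>All orbits have the same accumulation points on the boundary, so the union over all orbits is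
  the limit set computed from any one of them; it is empty if \<open>M\<close> is.\<close>

definition limit_set ::
  "('g, 'm) monoid_scheme \<Rightarrow> 's set \<Rightarrow> ('s \<Rightarrow> 's \<Rightarrow> real) \<Rightarrow> ('g \<Rightarrow> 's \<Rightarrow> 's) \<Rightarrow>
     (nat \<Rightarrow> 's) set set" where
  "limit_set G M d \<phi> = (\<Union>x\<in>M. accumulation_points M d (orbit G \<phi> x))"

definition elementary_action ::
  "('g, 'm) monoid_scheme \<Rightarrow> 's set \<Rightarrow> ('s \<Rightarrow> 's \<Rightarrow> real) \<Rightarrow> ('g \<Rightarrow> 's \<Rightarrow> 's) \<Rightarrow> bool" where
  "elementary_action G M d \<phi> \<longleftrightarrow>
     finite (limit_set G M d \<phi>) \<and> card (limit_set G M d \<phi>) \<le> 2"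

text \<open>HOL cannot quantify over types inside a formula, so the ambient type \<open>'s\<close> of the points of
  the space is a parameter, while the carrier \<open>M\<close> ranges over all subsets of \<open>'s\<close>.\<close>

definition acylindrically_hyperbolic ::
  "'s itself \<Rightarrow> ('g, 'm) monoid_scheme \<Rightarrow> bool" where
  "acylindrically_hyperbolic (_ :: 's itself) G \<longleftrightarrow>
     group G \<and>
     (\<exists>(M :: 's set) d \<phi>. hyperbolic_space M d \<and> acylindrical_action G M d \<phi> \<and>
        \<not> elementary_action G M d \<phi>)"

end

theory Submission
  imports Defs
begin

text \<open>
  An acylindrical action restricts to an acylindrical action of \<open>H\<close>, so the point is that an
  s-normal subgroup \<open>H\<close> with an elementary action forces the action of \<open>G\<close> to be elementary.

  If no element of \<open>H\<close> is loxodromic, then the orbit of \<open>H\<close> is bounded: otherwise any two far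
  orbit points have a large Gromov product, and a finite set of elements of \<open>H\<close>, of any size,
  moves all points sufficiently deep inside a long geodesic \<open>[p, h p]\<close> by a bounded amount only,
  against acylindricity. As \<open>H\<close> has bounded orbits, the infinite group \<open>H \<inter> H\<^sup>g\<close> moves both
  \<open>p\<close> and \<open>g\<^sup>-\<^sup>1 p\<close> by a bounded amount, so acylindricity bounds the distance between these
  two points. Hence all orbits of \<open>G\<close> are bounded and its limit set is empty.

  If \<open>H\<close> contains a loxodromic element \<open>f\<close> and has at most two limit points, then these are the
  ends of the quasi-line of the points \<open>f\<^sup>i p\<close>, and \<open>H p\<close> stays close to it. By acylindricity
  \<open>\<langle>f\<rangle>\<close> has finite index in \<open>H\<close>. Since \<open>H \<inter> H\<^sup>g\<close> is infinite, some non-trivial power of \<open>f\<close>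
  is conjugated by \<open>g\<close> to a non-trivial power of \<open>f\<close>, so \<open>g\<close> maps the quasi-line to one with the
  same ends. Hence \<open>G p\<close> stays close to the quasi-line and \<open>G\<close> has no limit points but its two ends.
\<close>

section \<open>Gromov products\<close>

lemma (in Metric_space) gromov_product_commute:
  "gromov_product d p x y = gromov_product d p y x"
  by (simp add: gromov_product_def commute)

lemma (in Metric_space) two_gromov_product:
  "2 * gromov_product d p x y = d p x + d p y - d x y"
  by (simp add: gromov_product_def commute)

lemma (in Metric_space) gromov_product_nonneg:
  "\<lbrakk>p \<in> M; x \<in> M; y \<in> M\<rbrakk> \<Longrightarrow> 0 \<le> gromov_product d p x y"
  using triangle[of x p y] by (simp add: gromov_product_def commute)

text \<open>Exchanges an upper bound on a product at one vertex of a triangle for a lower bound at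
  another; most estimates below turn on this.\<close>

lemma (in Metric_space) gromov_product_swap:
  "gromov_product d p x y = d p x - gromov_product d x p y"
  by (simp add: gromov_product_def commute field_simps)

lemma (in Metric_space) gromov_product_ge:
  "\<lbrakk>p \<in> M; x \<in> M; y \<in> M\<rbrakk> \<Longrightarrow> d p x - d x y \<le> gromov_product d p x y"
  using triangle[of p y x] by (simp add: gromov_product_def commute)

lemma (in Metric_space) gromov_product_base_change:
  "\<lbrakk>p \<in> M; q \<in> M; x \<in> M; y \<in> M\<rbrakk>
    \<Longrightarrow> gromov_product d q x y - d p q \<le> gromov_product d p x y"
  using triangle[of x p q] triangle[of y p q]
  by (simp add: gromov_product_def commute field_simps)

section \<open>From slim triangles to the four-point inequality\<close>

lemma geodesic_segment_between:
  assumes "geodesic_segment M d x y A" "q \<in> A"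
  shows "q \<in> M" "d x q + d q y = d x y"
proof -
  obtain \<gamma> where \<gamma>: "\<gamma> ` {0..d x y} = A" "A \<subseteq> M" "\<gamma> 0 = x" "\<gamma> (d x y) = y"
    and iso: "\<And>s t. s \<in> {0..d x y} \<Longrightarrow> t \<in> {0..d x y} \<Longrightarrow> d (\<gamma> s) (\<gamma> t) = \<bar>s - t\<bar>"
    using assms(1) unfolding geodesic_segment_def by blast
  show "q \<in> M" using \<gamma>(2) assms(2) by blast
  obtain t where t: "t \<in> {0..d x y}" "q = \<gamma> t" using \<gamma>(1) assms(2) by blast
  show "d x q + d q y = d x y"
    using iso[of 0 t] iso[of t "d x y"] t \<gamma>(3,4) by auto
qed

lemma (in Metric_space) geodesic_segment_interpolation:
  assumes "geodesic_segment M d x y A" "0 \<le> t" "t \<le> d x y"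
  shows "\<exists>z\<in>M. d x z = t \<and> d z y = d x y - t"
proof -
  obtain \<gamma> where \<gamma>: "\<gamma> ` {0..d x y} = A" "A \<subseteq> M" "\<gamma> 0 = x" "\<gamma> (d x y) = y"
    and iso: "\<And>s t. s \<in> {0..d x y} \<Longrightarrow> t \<in> {0..d x y} \<Longrightarrow> d (\<gamma> s) (\<gamma> t) = \<bar>s - t\<bar>"
    using assms(1) unfolding geodesic_segment_def by blast
  have "\<gamma> t \<in> M" using \<gamma>(1,2) assms by auto
  moreover have "d x (\<gamma> t) = t" "d (\<gamma> t) y = d x y - t"
    using iso[of 0 t] iso[of t "d x y"] \<gamma>(3,4) assms by auto
  ultimately show ?thesis by blast
qed

text \<open>A point of \<open>A\<close> close to both \<open>B\<close> and \<open>C\<close> exists since \<open>A\<close> is connected; taking a supremum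
  along \<open>A\<close> instead costs the additional constant \<open>1\<close>.\<close>
lemma (in Metric_space) geodesic_segment_covered:
  assumes A: "geodesic_segment M d x y A"
    and cover: "A \<subseteq> nbhd M d \<delta> B \<union> nbhd M d \<delta> C"
    and "y \<in> B" "x \<in> C" "B \<subseteq> M" "C \<subseteq> M" "\<delta> \<ge> 0"
  obtains q b c where "q \<in> A" "b \<in> B" "d q b \<le> \<delta> + 1" "c \<in> C" "d q c \<le> \<delta> + 1"
proof -
  obtain \<gamma> where \<gamma>: "\<gamma> ` {0..d x y} = A" "A \<subseteq> M" "\<gamma> 0 = x" "\<gamma> (d x y) = y"
    and iso: "\<And>s t. s \<in> {0..d x y} \<Longrightarrow> t \<in> {0..d x y} \<Longrightarrow> d (\<gamma> s) (\<gamma> t) = \<bar>s - t\<bar>"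
    using A unfolding geodesic_segment_def by blast
  define T where "T = {t \<in> {0..d x y}. \<gamma> t \<in> nbhd M d \<delta> C}"
  have mem: "\<gamma> t \<in> A" "\<gamma> t \<in> M" if "t \<in> {0..d x y}" for t
    using \<gamma>(1,2) that by auto
  have "x \<in> M" using mem(2)[of 0] \<gamma>(3) by simp
  then have "x \<in> nbhd M d \<delta> C"
    using assms by (auto simp: nbhd_def intro!: bexI[of _ x])
  then have "0 \<in> T" using \<gamma>(3) by (simp add: T_def)
  have bdd: "bdd_above T" by (rule bdd_aboveI[of _ "d x y"]) (auto simp: T_def)
  define s where "s = Sup T"
  have "0 \<le> s" using \<open>0 \<in> T\<close> bdd by (simp add: s_def cSup_upper)
  have "T \<noteq> {}" using \<open>0 \<in> T\<close> by blast
  then have "s \<le> d x y"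
    unfolding s_def by (rule cSup_least) (simp add: T_def)
  obtain t where t: "t \<in> T" "s - 1/2 < t"
    using less_cSup_iff[of T "s - 1/2"] \<open>0 \<in> T\<close> bdd by (auto simp: s_def)
  have "t \<le> s" using t bdd by (simp add: s_def cSup_upper)
  \<comment> \<open>Just above the supremum all points are covered by \<open>B\<close>; if
    \<open>s + 1/2\<close> leaves the interval, the endpoint \<open>y\<close> of \<open>A\<close>,
    which lies in \<open>B\<close>, serves instead. Both \<open>t\<close> and \<open>u\<close> are
    within \<open>1/2\<close> of \<open>s\<close>, whence the \<open>1\<close>.\<close>
  obtain u where u: "u \<in> {0..d x y}" "\<gamma> u \<in> nbhd M d \<delta> B" "s \<le> u" "u \<le> s + 1/2"
  proof (cases "s + 1/2 \<le> d x y")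
    case True
    then have "s + 1/2 \<notin> T" using bdd cSup_upper[of "s + 1/2" T] by (auto simp: s_def)
    with True \<open>0 \<le> s\<close> cover mem(1)[of "s + 1/2"] show ?thesis
      by (intro that[of "s + 1/2"]) (auto simp: T_def)
  next
    case False
    have "y \<in> M" using mem(2)[of "d x y"] \<gamma>(4) by simp
    then have "\<gamma> (d x y) \<in> nbhd M d \<delta> B"
      using \<gamma>(4) assms by (auto simp: nbhd_def intro!: bexI[of _ y])
    with False \<open>s \<le> d x y\<close> show ?thesis by (intro that[of "d x y"]) auto
  qed
  have tI: "t \<in> {0..d x y}" using t by (simp add: T_def)
  obtain b where b: "b \<in> B" "d (\<gamma> u) b \<le> \<delta>" using u by (auto simp: nbhd_def)
  obtain c where c: "c \<in> C" "d (\<gamma> t) c \<le> \<delta>" using t by (auto simp: nbhd_def T_def)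
  have "d (\<gamma> t) (\<gamma> u) \<le> 1"
    using iso[OF tI u(1)] t(2) u(3,4) \<open>t \<le> s\<close> by linarith
  then have "d (\<gamma> t) b \<le> \<delta> + 1"
    using triangle[of "\<gamma> t" "\<gamma> u" b] b mem(2)[OF tI] mem(2)[OF u(1)] \<open>B \<subseteq> M\<close> by auto
  then show ?thesis using b c mem(1)[OF tI] by (intro that[of "\<gamma> t" b c]) auto
qed

text \<open>In four-point form hyperbolicity becomes a matter of inequalities between distances. Of
  geodesicity the locale keeps only the existence of points at prescribed distances from two
  endpoints.\<close>

locale gromov_hyperbolic = Metric_space M d for M :: "'s set" and d +
  fixes \<delta> :: real
  assumes delta_nonneg: "0 \<le> \<delta>"
    and four_point: "\<lbrakk>p \<in> M; x \<in> M; y \<in> M; z \<in> M\<rbrakk>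
      \<Longrightarrow> min (gromov_product d p x y) (gromov_product d p y z) - \<delta> \<le> gromov_product d p x z"
    and interpolation: "\<lbrakk>x \<in> M; y \<in> M; 0 \<le> t; t \<le> d x y\<rbrakk>
      \<Longrightarrow> \<exists>z\<in>M. d x z = t \<and> d z y = d x y - t"

text \<open>In a slim triangle the Gromov product \<open>(x|z)\<^sub>p\<close> is the distance from \<open>p\<close> to a geodesic
  from \<open>x\<close> to \<open>z\<close>, up to a bounded error.\<close>
lemma hyperbolic_space_imp_gromov_hyperbolic:
  assumes "hyperbolic_space M d"
  obtains \<delta> where "gromov_hyperbolic M d \<delta>"
proof -
  interpret Metric_space M d using assms unfolding hyperbolic_space_def by blast
  have geo: "\<And>x y. x \<in> M \<Longrightarrow> y \<in> M \<Longrightarrow> \<exists>A. geodesic_segment M d x y A"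
    using assms unfolding hyperbolic_space_def by blast
  obtain \<delta> where \<delta>: "\<delta> \<ge> 0" and slim: "\<And>x y z A B C.
      \<lbrakk>x \<in> M; y \<in> M; z \<in> M; geodesic_segment M d x y A; geodesic_segment M d y z B;
       geodesic_segment M d z x C\<rbrakk> \<Longrightarrow> A \<subseteq> nbhd M d \<delta> B \<union> nbhd M d \<delta> C"
    using assms unfolding hyperbolic_space_def by (elim conjE exE) (rule that, assumption, blast)
  have ends: "x \<in> A" "y \<in> A" if A: "geodesic_segment M d x y A" for x y A
  proof -
    obtain \<gamma> where \<gamma>: "\<gamma> ` {0..d x y} = A" "\<gamma> 0 = x" "\<gamma> (d x y) = y"
      using A unfolding geodesic_segment_def by blast
    have "\<gamma> 0 \<in> A" "\<gamma> (d x y) \<in> A" unfolding \<gamma>(1)[symmetric] by auto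
    then show "x \<in> A" "y \<in> A" using \<gamma> by auto
  qed
  have sub: "A \<subseteq> M" if "geodesic_segment M d x y A" for x y A
    using that unfolding geodesic_segment_def by blast
  have lower: "gromov_product d p x y \<le> d p q"
    if "geodesic_segment M d x y A" "q \<in> A" "p \<in> M" "x \<in> M" "y \<in> M" for p x y q A
  proof -
    have q: "q \<in> M" "d x q + d q y = d x y"
      using geodesic_segment_between[OF that(1,2)] by auto
    show ?thesis
      using triangle[of p q x] triangle[of p q y] q that
      by (simp add: gromov_product_def commute)
  qed
  \<comment> \<open>A point \<open>q\<close> between \<open>x\<close> and \<open>z\<close> that is
    \<open>\<delta> + 1\<close>-close to both sides at \<open>p\<close> has distance from
    \<open>p\<close> at most \<open>2 * (\<delta> + 1)\<close> above the product of \<open>x\<close>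
    and \<open>z\<close>. Moving to \<open>r\<close> on another side of the triangle
    \<open>x\<close>, \<open>z\<close>, \<open>y\<close> costs \<delta>, and by \<open>lower\<close>
    the distance from \<open>p\<close> to \<open>r\<close> dominates one of the two products with
    \<open>y\<close>.\<close>
  have four: "min (gromov_product d p x y) (gromov_product d p y z) - (3 * \<delta> + 2)
      \<le> gromov_product d p x z"
    if M: "p \<in> M" "x \<in> M" "y \<in> M" "z \<in> M" for p x y z
  proof -
    obtain A where A: "geodesic_segment M d x z A" using geo M by blast
    obtain B where B: "geodesic_segment M d z p B" using geo M by blast
    obtain C where C: "geodesic_segment M d p x C" using geo M by blast
    obtain B' where B': "geodesic_segment M d z y B'" using geo M by blast
    obtain C' where C': "geodesic_segment M d y x C'" using geo M by blast
    obtain q b c where q: "q \<in> A" and b: "b \<in> B" "d q b \<le> \<delta> + 1"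
      and c: "c \<in> C" "d q c \<le> \<delta> + 1"
      using geodesic_segment_covered[OF A slim[OF M(2,4,1) A B C] ends(1)[OF B] ends(2)[OF C]
          sub[OF B] sub[OF C] \<delta>]
      by blast
    have qM: "q \<in> M" "b \<in> M" "c \<in> M" using q b c sub[OF A] sub[OF B] sub[OF C] by auto
    have "2 * d p q \<le> d p x + d p z - d x z + 4 * (\<delta> + 1)"
      using geodesic_segment_between(2)[OF A q] geodesic_segment_between(2)[OF B b(1)]
        geodesic_segment_between(2)[OF C c(1)] b(2) c(2)
        triangle[of p b q] triangle[of p c q] triangle[of q b z] triangle[of q c x] qM M
      by (simp add: commute)
    then have pq: "d p q \<le> gromov_product d p x z + 2 * (\<delta> + 1)"
      by (simp add: gromov_product_def commute field_simps)
    have "q \<in> nbhd M d \<delta> B' \<union> nbhd M d \<delta> C'"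
      using slim[OF M(2,4,3) A B' C'] q by blast
    then obtain r where r: "r \<in> M" "r \<in> B' \<or> r \<in> C'" "d q r \<le> \<delta>"
      using sub[OF B'] sub[OF C'] by (auto simp: nbhd_def)
    have "min (gromov_product d p x y) (gromov_product d p y z) \<le> d p r"
      using r(2) lower[OF B' _ M(1,4,3), of r] lower[OF C' _ M(1,3,2), of r]
        gromov_product_commute[of p x y] gromov_product_commute[of p y z] by auto
    also have "d p r \<le> gromov_product d p x z + (3 * \<delta> + 2)"
      using pq r(3) triangle[OF M(1) qM(1) r(1)] by (simp add: algebra_simps)
    finally show ?thesis by (simp only: diff_le_eq)
  qed
  have "gromov_hyperbolic M d (3 * \<delta> + 2)"
  proof
    show "\<exists>z\<in>M. d x z = t \<and> d z y = d x y - t"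
      if "x \<in> M" "y \<in> M" "0 \<le> t" "t \<le> d x y" for x y t
      using geo[OF that(1,2)] geodesic_segment_interpolation that(3,4) by blast
  qed (use \<delta> four in auto)
  then show ?thesis by (rule that)
qed

context gromov_hyperbolic
begin

abbreviation gp where "gp \<equiv> gromov_product d"

text \<open>Both points lie near a geodesic from \<open>z\<close> to \<open>w\<close>, so seen from
  \<open>z\<close> each has a product with \<open>w\<close> close to its own distance. The
  four-point inequality through \<open>w\<close> then bounds the product of \<open>x\<close> and
  \<open>y\<close> from below.\<close>

lemma dist_le_of_near_geodesic:
  assumes M: "x \<in> M" "y \<in> M" "z \<in> M" "w \<in> M"
    and "gp x z w \<le> b" "gp y z w \<le> b"
  shows "d x y \<le> \<bar>d z x - d z y\<bar> + 2 * b + 2 * \<delta>"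
proof -
  have "d z x - b \<le> gp z x w" "d z y - b \<le> gp z w y"
    using gromov_product_swap[of z x w] gromov_product_swap[of z y w] assms
      gromov_product_commute[of z y w] by auto
  with four_point[of z x w y] M
  have "min (d z x) (d z y) - b - \<delta> \<le> gp z x y" by linarith
  moreover have "2 * gp z x y = d z x + d z y - d x y"
    by (simp add: gromov_product_def commute)
  ultimately show ?thesis by (auto simp: min_def split: if_splits)
qed

text \<open>This is \<open>four_point\<close> with the base point eliminated. Applied to all
  pairings, it says that the two largest of the three sums of opposite distances differ by at most
  \<open>2 * \<delta>\<close>.\<close>

lemma four_point_dist:
  assumes M: "x \<in> M" "y \<in> M" "z \<in> M" "w \<in> M"
  shows "d x y + d z w \<le> max (d x z + d y w) (d x w + d y z) + 2 * \<delta>"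
proof -
  have "2 * gp w x z = d x w + d z w - d x z"
    "2 * gp w z y = d z w + d y w - d y z"
    "2 * gp w x y = d x w + d y w - d x y"
    by (simp_all add: gromov_product_def commute)
  with four_point[of w x z y] M show ?thesis
    by (auto simp: min_def split: if_splits)
qed

lemma four_point3:
  assumes M: "p \<in> M" "x \<in> M" "y \<in> M" "z \<in> M" "w \<in> M"
  shows "min (gp p x y) (min (gp p y z) (gp p z w)) - 2 * \<delta> \<le> gp p x w"
  using four_point[of p x y z] four_point[of p x z w] assms delta_nonneg by linarith

end

section \<open>Quasi-lines\<close>

text \<open>A quasi-geodesic indexed by the integers. The last clause builds in stability: each
  point stays near every geodesic from an earlier to a later point.\<close>

definition quasi_line :: "'s set \<Rightarrow> ('s \<Rightarrow> 's \<Rightarrow> real) \<Rightarrow> real \<Rightarrow> real \<Rightarrow> real \<Rightarrow> (int \<Rightarrow> 's) \<Rightarrow> bool" where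
  "quasi_line M d b c L x \<longleftrightarrow>
     range x \<subseteq> M \<and>
     (\<forall>i. d (x i) (x (i + 1)) \<le> L) \<and>
     (\<forall>i j. c * real_of_int \<bar>i - j\<bar> \<le> d (x i) (x j)) \<and>
     (\<forall>i j k. i \<le> j \<longrightarrow> j \<le> k \<longrightarrow> gromov_product d (x j) (x i) (x k) \<le> b)"

context gromov_hyperbolic
begin

lemma quasi_lineD:
  assumes "quasi_line M d b c L x"
  shows "x i \<in> M" "d (x i) (x (i + 1)) \<le> L" "c * real_of_int \<bar>i - j\<bar> \<le> d (x i) (x j)"
    "i \<le> j \<Longrightarrow> j \<le> k \<Longrightarrow> gp (x j) (x i) (x k) \<le> b"
  using assms unfolding quasi_line_def by auto

lemma quasi_line_nonneg:
  assumes "quasi_line M d b c L x"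
  shows "0 \<le> b" "0 \<le> L"
proof -
  have "gp (x 0) (x 0) (x 0) \<le> b" using quasi_lineD(4)[OF assms, of 0 0 0] by simp
  then show "0 \<le> b"
    using gromov_product_nonneg[of "x 0" "x 0" "x 0"] quasi_lineD(1)[OF assms] by force
  show "0 \<le> L" by (rule order_trans[OF nonneg quasi_lineD(2)[OF assms, of 0]])
qed

lemma quasi_line_reverse:
  assumes x: "quasi_line M d b c L x"
  shows "quasi_line M d b c L (\<lambda>i. x (- i))"
  unfolding quasi_line_def
proof (intro conjI allI impI)
  show "d (x (- i)) (x (- (i + 1))) \<le> L" for i
    using quasi_lineD(2)[OF x, of "- i - 1"] by (simp add: commute)
  show "c * real_of_int \<bar>i - j\<bar> \<le> d (x (- i)) (x (- j))" for i j
    using quasi_lineD(3)[OF x, of "- i" "- j"] by (simp add: abs_minus_commute)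
  show "gp (x (- j)) (x (- i)) (x (- k)) \<le> b" if "i \<le> j" "j \<le> k" for i j k
    using quasi_lineD(4)[OF x, of "- k" "- j" "- i"] that by (simp add: gromov_product_commute)
qed (use quasi_lineD(1)[OF x] in auto)

lemma quasi_line_dist_le:
  assumes x: "quasi_line M d b c L x"
  shows "d (x i) (x (i + int n)) \<le> L * n"
proof (induction n)
  case (Suc n)
  then show ?case
    using quasi_lineD(2)[OF x, of "i + int n"] quasi_lineD(1)[OF x]
      triangle[of "x i" "x (i + int n)" "x (i + int n + 1)"]
    by (simp add: algebra_simps)
qed (use quasi_lineD(1)[OF x] in simp)

text \<open>A path whose steps are long compared with the products at its corners makes steady
  progress. By induction the last step keeps a small product with the way back to
  \<open>x m\<close>, so each new step adds at least \<open>L - 2 * (a + \<delta>)\<close> to the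
  distance.\<close>

lemma broken_geodesic:
  fixes x :: "int \<Rightarrow> 's"
  assumes M: "\<And>i. x i \<in> M" and L: "\<And>i. d (x i) (x (i + 1)) = L"
    and a: "\<And>i. gp (x i) (x (i - 1)) (x (i + 1)) \<le> a" and "2 * a + 2 * \<delta> < L"
  shows "gp (x (m + int n)) (x m) (x (m + int n + 1)) \<le> a + \<delta>"
    and "(L - 2 * a - 2 * \<delta>) * n \<le> d (x m) (x (m + int n))"
proof -
  have "0 \<le> a" using order_trans[OF gromov_product_nonneg a] M by blast
  show *: "gp (x (m + int n)) (x m) (x (m + int n + 1)) \<le> a + \<delta>" for n
  proof (induction n)
    case 0
    show ?case using \<open>0 \<le> a\<close> delta_nonneg M by (simp add: gromov_product_def commute)
  next
    case (Suc n)
    define j where "j = m + int n"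
    have "gp (x (j + 1)) (x j) (x m) = L - gp (x j) (x m) (x (j + 1))"
      using gromov_product_swap[of "x (j + 1)" "x j" "x m"] L[of j]
      by (simp add: commute gromov_product_commute)
    then have "a + \<delta> < gp (x (j + 1)) (x j) (x m)"
      using Suc \<open>2 * a + 2 * \<delta> < L\<close> by (simp add: j_def)
    \<comment> \<open>Seen from the new corner, \<open>x j\<close> and \<open>x m\<close> have
      product above \<open>a + \<delta>\<close>, so the minimum must be the other term.\<close>
    moreover have "min (gp (x (j + 1)) (x j) (x m)) (gp (x (j + 1)) (x m) (x (j + 2))) - \<delta> \<le> a"
      using four_point[OF M M M M, of "j + 1" j m "j + 2"] a[of "j + 1"]
      by (simp add: algebra_simps)
    ultimately show ?case by (simp add: j_def algebra_simps)
  qed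
  show "(L - 2 * a - 2 * \<delta>) * n \<le> d (x m) (x (m + int n))"
  proof (induction n)
    case (Suc n)
    have "d (x m) (x (m + int n + 1))
        = d (x m) (x (m + int n)) + L - 2 * gp (x (m + int n)) (x m) (x (m + int n + 1))"
      using L[of "m + int n"] two_gromov_product[of "x (m + int n)" "x m" "x (m + int n + 1)"]
        commute[of "x (m + int n)" "x m"] by simp
    then show ?case using Suc *[of n] by (simp add: algebra_simps)
  qed simp
qed

text \<open>The previous lemma is applied to the sequence and to its reverse. At \<open>x j\<close>
  an earlier point has small product with the next point, whereas a later point has large product
  with it; the third \<delta> in \<open>less\<close> makes the gap wide enough for the four-point
  inequality.\<close>

lemma local_quasi_line:
  fixes x :: "int \<Rightarrow> 's"
  assumes M: "\<And>i. x i \<in> M" and L: "\<And>i. d (x i) (x (i + 1)) = L"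
    and a: "\<And>i. gp (x i) (x (i - 1)) (x (i + 1)) \<le> a" and less: "2 * a + 3 * \<delta> < L"
  shows "quasi_line M d (a + 2 * \<delta>) (L - 2 * a - 2 * \<delta>) L x"
proof -
  have less': "2 * a + 2 * \<delta> < L" using less delta_nonneg by linarith
  have "0 \<le> a" using order_trans[OF gromov_product_nonneg a] M by blast
  note forward = broken_geodesic[of x, OF M L a less']
  have L': "d (x (- i)) (x (- (i + 1))) = L" for i
    using L[of "- i - 1"] by (simp add: commute)
  have a': "gp (x (- i)) (x (- (i - 1))) (x (- (i + 1))) \<le> a" for i
    using a[of "- i"] by (simp add: gromov_product_commute)
  note backward = broken_geodesic[of "\<lambda>i. x (- i)", OF M L' a' less']
  have dist: "(L - 2 * a - 2 * \<delta>) * real_of_int \<bar>i - j\<bar> \<le> d (x i) (x j)" for i j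
  proof (cases "i \<le> j")
    case True
    then show ?thesis using forward(2)[of "nat (j - i)" i] by simp
  next
    case False
    then show ?thesis using forward(2)[of "nat (i - j)" j] by (simp add: commute)
  qed
  have "gp (x j) (x i) (x k) \<le> a + 2 * \<delta>" if "i \<le> j" "j \<le> k" for i j k
  proof (cases "j = k")
    case True
    then show ?thesis using \<open>0 \<le> a\<close> delta_nonneg M by (simp add: gromov_product_def commute)
  next
    case False
    then have "j + 1 \<le> k" using that by simp
    have 1: "gp (x j) (x i) (x (j + 1)) \<le> a + \<delta>"
      using forward(1)[of i "nat (j - i)"] that by simp
    have "gp (x (j + 1)) (x k) (x j) \<le> a + \<delta>"
      using backward(1)[of "- k" "nat (k - (j + 1))"] \<open>j + 1 \<le> k\<close> by (simp add: add.commute)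
    moreover have "gp (x j) (x (j + 1)) (x k) = L - gp (x (j + 1)) (x k) (x j)"
      using gromov_product_swap[of "x j" "x (j + 1)" "x k"] L[of j]
      by (simp add: gromov_product_commute)
    ultimately have "a + 2 * \<delta> < gp (x j) (x k) (x (j + 1))"
      using less by (simp add: gromov_product_commute)
    then show ?thesis
      using 1 four_point[of "x j" "x i" "x k" "x (j + 1)"] M by force
  qed
  with M L dist show ?thesis unfolding quasi_line_def by auto
qed

text \<open>The first index at which the distance from \<open>x m\<close> reaches \<open>s\<close>
  overshoots by at most one step, hence by at most \<open>L\<close>.\<close>

lemma quasi_line_discrete_ivt:
  assumes x: "quasi_line M d b c L x" and "m \<le> k" "0 \<le> s" "s \<le> d (x m) (x k)"
  shows "\<exists>j. m \<le> j \<and> j \<le> k \<and> \<bar>d (x m) (x j) - s\<bar> \<le> L"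
proof -
  define n where "n = (LEAST n. s \<le> d (x m) (x (m + int n)))"
  have ex: "s \<le> d (x m) (x (m + int (nat (k - m))))" using assms by simp
  have n: "s \<le> d (x m) (x (m + int n))"
    unfolding n_def by (rule LeastI[where P = "\<lambda>n. s \<le> d (x m) (x (m + int n))", OF ex])
  have le: "n \<le> nat (k - m)"
    unfolding n_def by (rule Least_le[where P = "\<lambda>n. s \<le> d (x m) (x (m + int n))", OF ex])
  have "d (x m) (x (m + int n)) \<le> s + L"
  proof (cases n)
    case 0
    then have "d (x m) (x (m + int n)) = 0" using quasi_lineD(1)[OF x, of m] by simp
    then show ?thesis using \<open>0 \<le> s\<close> quasi_line_nonneg(2)[OF x] by linarith
  next
    case (Suc n')
    then have "n' < (LEAST n. s \<le> d (x m) (x (m + int n)))" by (simp add: n_def)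
    then have "\<not> s \<le> d (x m) (x (m + int n'))" by (rule not_less_Least)
    moreover have eq: "m + int n = m + int n' + 1" using Suc by simp
    have "d (x m) (x (m + int n)) \<le> d (x m) (x (m + int n')) + L"
      unfolding eq using quasi_lineD(2)[OF x, of "m + int n'"]
        triangle[OF quasi_lineD(1)[OF x] quasi_lineD(1)[OF x] quasi_lineD(1)[OF x],
          of m "m + int n' + 1" "m + int n'"]
      by linarith
    ultimately show ?thesis by linarith
  qed
  with n le \<open>m \<le> k\<close> show ?thesis by (intro exI[of _ "m + int n"]) auto
qed

lemma near_quasi_line:
  assumes x: "quasi_line M d b c L x" and "y \<in> M" "gp y (x m) (x k) \<le> b'" "b \<le> b'"
  shows "\<exists>i. d y (x i) \<le> L + 4 * b' + 2 * \<delta>"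
proof -
  have *: ?thesis if "m \<le> k" "gp y (x m) (x k) \<le> b'" for m k
  proof -
    define z w where "z = x m" and "w = x k"
    have M: "z \<in> M" "w \<in> M" using quasi_lineD(1)[OF x] by (auto simp: z_def w_def)
    \<comment> \<open>\<open>y\<close> is compared with a point of the quasi-line at about the same
      distance from \<open>z\<close>. The minimum keeps \<open>s\<close> within reach when
      \<open>y\<close> is farther away than \<open>w\<close>, which happens by at most
      \<open>2 * b'\<close>.\<close>
    define s where "s = min (d z y) (d z w)"
    obtain j where j: "m \<le> j" "j \<le> k" "\<bar>d z (x j) - s\<bar> \<le> L"
      using quasi_line_discrete_ivt[OF x \<open>m \<le> k\<close>, of s] by (auto simp: z_def w_def s_def)
    have "gp (x j) z w \<le> b'"
      using quasi_lineD(4)[OF x j(1,2)] \<open>b \<le> b'\<close> by (simp add: z_def w_def)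
    then have "d y (x j) \<le> \<bar>d z y - d z (x j)\<bar> + 2 * b' + 2 * \<delta>"
      using dist_le_of_near_geodesic[OF \<open>y \<in> M\<close> quasi_lineD(1)[OF x] M] that
      by (simp add: z_def w_def)
    moreover have "d z y \<le> d z w + 2 * b'"
      using that two_gromov_product[of y z w] nonneg[of y w] commute[of y z]
      unfolding z_def w_def by linarith
    then have "\<bar>d z y - s\<bar> \<le> 2 * b'"
      using quasi_line_nonneg[OF x] \<open>b \<le> b'\<close> by (auto simp: s_def)
    ultimately show ?thesis using j(3) by (intro exI[of _ j]) linarith
  qed
  show ?thesis
    using *[of m k] *[of k m] assms(3) by (cases "m \<le> k") (simp_all add: gromov_product_commute)
qed

text \<open>Seen from \<open>y 0\<close>, the points \<open>x m\<close> and \<open>x k\<close> lie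
  in the directions of \<open>y n\<close> and \<open>y n'\<close>, whose product is at most
  \<open>b\<close>. Hence \<open>x m\<close> and \<open>x k\<close> have product at most
  \<open>b + 2 * \<delta>\<close>, and \<open>near_quasi_line\<close> applies with this value as
  \<open>b'\<close>.\<close>

lemma quasi_lines_close:
  assumes x: "quasi_line M d b c L x" and y: "quasi_line M d b c L y"
    and "n \<le> 0" "0 \<le> n'"
    and "b + 2 * \<delta> < gp (y 0) (y n) (x m)" "b + 2 * \<delta> < gp (y 0) (y n') (x k)"
  shows "\<exists>i. d (y 0) (x i) \<le> L + 4 * b + 10 * \<delta>"
proof -
  have "gp (y 0) (y n) (y n') \<le> b" using quasi_lineD(4)[OF y] assms by blast
  then have "gp (y 0) (x m) (x k) \<le> b + 2 * \<delta>"
    using four_point3[of "y 0" "y n" "x m" "x k" "y n'"] assms(5,6)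
      quasi_lineD(1)[OF x] quasi_lineD(1)[OF y] gromov_product_commute[of "y 0" "y n'" "x k"]
    by fastforce
  from near_quasi_line[OF x _ this] show ?thesis
    using quasi_lineD(1)[OF y] delta_nonneg by (simp add: algebra_simps)
qed

section \<open>The boundary\<close>

text \<open>One base point suffices, since changing it alters products by at most the distance
  between the two base points.\<close>

lemma gromov_products_diverge_iff:
  assumes p: "p \<in> M" and u: "range u \<subseteq> M" and v: "range v \<subseteq> M"
  shows "gromov_products_diverge M d u v \<longleftrightarrow> (\<forall>B. \<exists>N. \<forall>i\<ge>N. \<forall>j\<ge>N. B \<le> gp p (u i) (v j))"
    (is "_ \<longleftrightarrow> (\<forall>B. ?P p B)")
proof -
  have "filterlim (\<lambda>(i, j). gp q (u i) (v j)) at_top (sequentially \<times>\<^sub>F sequentially)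
      \<longleftrightarrow> (\<forall>B. ?P q B)" for q
    unfolding filterlim_at_top eventually_prod_sequentially by (auto 4 4)
  moreover have "?P q B" if "q \<in> M" "\<forall>B. ?P p B" for q B
  proof -
    from that obtain N where "\<forall>i\<ge>N. \<forall>j\<ge>N. B + d q p \<le> gp p (u i) (v j)" by blast
    then show ?thesis
      using gromov_product_base_change[OF \<open>q \<in> M\<close> p] u v
      by (intro exI[of _ N]) (smt (verit) range_subsetD)
  qed
  ultimately show ?thesis using p unfolding gromov_products_diverge_def by blast
qed

lemma boundary_rel_iff:
  "(u, v) \<in> boundary_rel M d \<longleftrightarrow> u \<in> converging_at_infinity M d \<and>
    v \<in> converging_at_infinity M d \<and> gromov_products_diverge M d u v"
  by (simp add: boundary_rel_def)

lemma converging_dist_at_infinity: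
  assumes "u \<in> converging_at_infinity M d" "p \<in> M"
  shows "\<exists>N. \<forall>i\<ge>N. B \<le> d p (u i)"
proof -
  obtain N where "\<forall>i\<ge>N. \<forall>j\<ge>N. B \<le> gp p (u i) (u j)"
    using assms gromov_products_diverge_iff[of p u u] unfolding converging_at_infinity_def
    by blast
  moreover have "u i \<in> M" for i using assms by (auto simp: converging_at_infinity_def)
  then have "gp p (u i) (u i) = d p (u i)" for i by (simp add: gromov_product_def commute)
  ultimately show ?thesis by metis
qed

text \<open>Transitivity is the four-point inequality through a late term of the middle
  sequence.\<close>

lemma equiv_boundary_rel: "equiv (converging_at_infinity M d) (boundary_rel M d)"
proof (rule equivI)
  show "boundary_rel M d \<subseteq> converging_at_infinity M d \<times> converging_at_infinity M d"
    by (auto simp: boundary_rel_def)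
  show "refl_on (converging_at_infinity M d) (boundary_rel M d)"
    by (auto simp: refl_on_def boundary_rel_iff converging_at_infinity_def)
  have range: "range u \<subseteq> M" if "u \<in> converging_at_infinity M d" for u
    using that by (simp add: converging_at_infinity_def)
  show "sym (boundary_rel M d)"
  proof (rule symI)
    fix u v assume uv: "(u, v) \<in> boundary_rel M d"
    then have M: "range u \<subseteq> M" "range v \<subseteq> M" using range by (auto simp: boundary_rel_iff)
    then have "u 0 \<in> M" by blast
    then show "(v, u) \<in> boundary_rel M d"
      using uv gromov_products_diverge_iff[OF _ M] gromov_products_diverge_iff[OF _ M(2,1)]
      unfolding boundary_rel_iff by (metis gromov_product_commute)
  qed
  show "trans (boundary_rel M d)"
  proof (rule transI)
    fix u v w assume uv: "(u, v) \<in> boundary_rel M d" and vw: "(v, w) \<in> boundary_rel M d"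
    then have M: "range u \<subseteq> M" "range v \<subseteq> M" "range w \<subseteq> M"
      using range by (auto simp: boundary_rel_iff)
    then have "u 0 \<in> M" by blast
    have "\<exists>N. \<forall>i\<ge>N. \<forall>j\<ge>N. B \<le> gp (u 0) (u i) (w j)" for B
    proof -
      obtain N1 where N1: "\<forall>i\<ge>N1. \<forall>j\<ge>N1. B + \<delta> \<le> gp (u 0) (u i) (v j)"
        using uv gromov_products_diverge_iff[OF \<open>u 0 \<in> M\<close> M(1,2)]
        unfolding boundary_rel_iff by blast
      obtain N2 where N2: "\<forall>i\<ge>N2. \<forall>j\<ge>N2. B + \<delta> \<le> gp (u 0) (v i) (w j)"
        using vw gromov_products_diverge_iff[OF \<open>u 0 \<in> M\<close> M(2,3)]
        unfolding boundary_rel_iff by blast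
      show ?thesis
      proof (intro exI[of _ "max N1 N2"] allI impI)
        fix i j assume "max N1 N2 \<le> i" "max N1 N2 \<le> j"
        then have "B + \<delta> \<le> gp (u 0) (u i) (v (max N1 N2))"
          "B + \<delta> \<le> gp (u 0) (v (max N1 N2)) (w j)"
          using N1 N2 by auto
        then show "B \<le> gp (u 0) (u i) (w j)"
          using four_point[of "u 0" "u i" "v (max N1 N2)" "w j"] M by force
      qed
    qed
    then have "gromov_products_diverge M d u w"
      using gromov_products_diverge_iff[OF \<open>u 0 \<in> M\<close> M(1,3)] by blast
    with uv vw show "(u, w) \<in> boundary_rel M d" by (simp add: boundary_rel_iff)
  qed
qed

text \<open>A single late pair \<open>u k\<close>, \<open>v l\<close> at distance at most
  \<open>D\<close> links all late terms: \<open>u i\<close> to \<open>u k\<close>,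
  \<open>u k\<close> to \<open>v l\<close>, and \<open>v l\<close> to \<open>v j\<close>. The middle
  product is large because \<open>u k\<close> is far from the base point.\<close>

lemma boundary_rel_of_close:
  assumes u: "u \<in> converging_at_infinity M d" and v: "v \<in> converging_at_infinity M d"
    and close: "\<And>N. \<exists>i\<ge>N. \<exists>j\<ge>N. d (u i) (v j) \<le> D"
  shows "(u, v) \<in> boundary_rel M d"
proof -
  have M: "range u \<subseteq> M" "range v \<subseteq> M" using u v by (auto simp: converging_at_infinity_def)
  then have p: "u 0 \<in> M" by blast
  have "\<exists>N. \<forall>i\<ge>N. \<forall>j\<ge>N. B \<le> gp (u 0) (u i) (v j)" for B
  proof -
    obtain N1 where N1: "\<forall>i\<ge>N1. \<forall>j\<ge>N1. B + 2 * \<delta> \<le> gp (u 0) (u i) (u j)"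
      using u gromov_products_diverge_iff[OF p M(1,1)]
      unfolding converging_at_infinity_def by blast
    obtain N2 where N2: "\<forall>i\<ge>N2. \<forall>j\<ge>N2. B + 2 * \<delta> \<le> gp (u 0) (v i) (v j)"
      using v gromov_products_diverge_iff[OF p M(2,2)]
      unfolding converging_at_infinity_def by blast
    obtain N3 where N3: "\<forall>i\<ge>N3. B + 2 * \<delta> + D \<le> d (u 0) (u i)"
      using converging_dist_at_infinity[OF u p] by blast
    define N where "N = max N1 (max N2 N3)"
    obtain k l where kl: "k \<ge> N" "l \<ge> N" "d (u k) (v l) \<le> D" using close by blast
    show ?thesis
    proof (intro exI[of _ N] allI impI)
      fix i j assume "N \<le> i" "N \<le> j"
      then have "B + 2 * \<delta> \<le> gp (u 0) (u i) (u k)" "B + 2 * \<delta> \<le> gp (u 0) (v l) (v j)"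
        "B + 2 * \<delta> + D \<le> d (u 0) (u k)"
        using N1 N2 N3 kl by (auto simp: N_def)
      then show "B \<le> gp (u 0) (u i) (v j)"
        using four_point3[of "u 0" "u i" "u k" "v l" "v j"] kl(3)
          gromov_product_ge[of "u 0" "u k" "v l"] M by (smt (verit) range_subsetD)
    qed
  qed
  then show ?thesis using u v gromov_products_diverge_iff[OF p M] by (simp add: boundary_rel_iff)
qed

lemma boundary_rel_imp_large_product:
  assumes "(u, v) \<in> boundary_rel M d" "p \<in> M"
  shows "\<exists>i j. B < gp p (u i) (v j)"
proof -
  have "range u \<subseteq> M" "range v \<subseteq> M"
    using assms by (auto simp: boundary_rel_def converging_at_infinity_def)
  then obtain N where "\<forall>i\<ge>N. \<forall>j\<ge>N. B + 1 \<le> gp p (u i) (v j)"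
    using assms gromov_products_diverge_iff[of p u v] unfolding boundary_rel_iff by blast
  then have "B + 1 \<le> gp p (u N) (v N)" by simp
  then show ?thesis by (intro exI[of _ N]) linarith
qed

text \<open>For \<open>i \<le> j\<close> the product at \<open>x i\<close> of \<open>x 0\<close> and
  \<open>x j\<close> is at most \<open>b\<close>, so the product at \<open>x 0\<close> is at least
  \<open>c * i - b\<close>.\<close>

lemma quasi_line_converging:
  assumes x: "quasi_line M d b c L x" and "0 < c"
  shows "(\<lambda>n. x (int n)) \<in> converging_at_infinity M d"
proof -
  have M: "range (\<lambda>n. x (int n)) \<subseteq> M" "x 0 \<in> M" using quasi_lineD(1)[OF x] by auto
  have *: "c * i - b \<le> gp (x 0) (x (int i)) (x (int j))" if "i \<le> j" for i j :: nat
    using gromov_product_swap[of "x 0" "x (int i)" "x (int j)"]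
      quasi_lineD(3)[OF x, of 0 "int i"] quasi_lineD(4)[OF x, of 0 "int i" "int j"] that
    by simp
  have "\<exists>N. \<forall>i\<ge>N. \<forall>j\<ge>N. B \<le> gp (x 0) (x (int i)) (x (int j))" for B
  proof -
    obtain N :: nat where N: "(B + b) / c < N" using reals_Archimedean2 by blast
    have N': "B \<le> c * i - b" if "N \<le> i" for i
    proof -
      have "(B + b) / c < i" using N that by simp
      then show ?thesis using \<open>0 < c\<close> by (simp add: field_simps)
    qed
    show ?thesis
    proof (intro exI[of _ N] allI impI)
      fix i j assume "N \<le> i" "N \<le> j"
      then show "B \<le> gp (x 0) (x (int i)) (x (int j))"
        using *[of i j] *[of j i] N'[of i] N'[of j]
          gromov_product_commute[of "x 0" "x (int i)" "x (int j)"]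
        by (cases "i \<le> j") auto
    qed
  qed
  then show ?thesis
    using M gromov_products_diverge_iff[of "x 0" "\<lambda>n. x (int n)" "\<lambda>n. x (int n)"]
    by (simp add: converging_at_infinity_def)
qed

lemma quasi_line_ends_distinct:
  assumes x: "quasi_line M d b c L x"
  shows "(\<lambda>n. x (int n), \<lambda>n. x (- int n)) \<notin> boundary_rel M d"
proof
  assume "(\<lambda>n. x (int n), \<lambda>n. x (- int n)) \<in> boundary_rel M d"
  then have "gromov_products_diverge M d (\<lambda>n. x (int n)) (\<lambda>n. x (- int n))"
    by (simp add: boundary_rel_iff)
  then obtain N where "\<forall>i\<ge>N. \<forall>j\<ge>N. b + 1 \<le> gp (x 0) (x (int i)) (x (- int j))"
    using gromov_products_diverge_iff[of "x 0"] quasi_lineD(1)[OF x] by (metis image_subsetI)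
  then have "b + 1 \<le> gp (x 0) (x (- int N)) (x (int N))"
    by (simp add: gromov_product_commute)
  then show False using quasi_lineD(4)[OF x, of "- int N" 0 "int N"] by simp
qed

text \<open>If neither end is the limit, late terms of \<open>u\<close> stay away from both tails of
  the quasi-line. They are then near its bounded middle part, although \<open>u\<close> leaves every
  ball.\<close>

lemma near_quasi_line_end:
  assumes x: "quasi_line M d b c L x" "0 < c"
    and u: "u \<in> converging_at_infinity M d" and near: "\<And>i. \<exists>k. d (u i) (x k) \<le> D"
  shows "(u, \<lambda>n. x (int n)) \<in> boundary_rel M d \<or> (u, \<lambda>n. x (- int n)) \<in> boundary_rel M d"
proof (rule ccontr)
  have M: "range u \<subseteq> M" "x k \<in> M" for k
    using u quasi_lineD(1)[OF x(1)] by (auto simp: converging_at_infinity_def)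
  note x' = quasi_line_reverse[OF x(1)]
  assume "\<not> ?thesis"
  with boundary_rel_of_close[OF u quasi_line_converging[OF x]]
    boundary_rel_of_close[OF u quasi_line_converging[OF x' x(2)]]
  obtain N1 N2 where N1: "\<And>i j. N1 \<le> i \<Longrightarrow> N1 \<le> j \<Longrightarrow> D < d (u i) (x (int j))"
    and N2: "\<And>i j. N2 \<le> i \<Longrightarrow> N2 \<le> j \<Longrightarrow> D < d (u i) (x (- int j))"
    by (meson not_le_imp_less)
  define N where "N = max N1 N2"
  obtain N3 where N3: "\<forall>i\<ge>N3. D + L * N + 1 \<le> d (x 0) (u i)"
    using converging_dist_at_infinity[OF u M(2)] by blast
  define i where "i = max N N3"
  obtain k where k: "d (u i) (x k) \<le> D" using near by blast
  have "D + L * N + 1 \<le> d (x 0) (u i)" using N3 by (simp add: i_def)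
  also have "d (x 0) (u i) \<le> d (x 0) (x k) + D"
    using triangle'[of "x 0" "x k" "u i"] M k by force
  also have "d (x 0) (x k) \<le> L * \<bar>k\<bar>"
    using quasi_line_dist_le[OF x(1), of 0 "nat k"] quasi_line_dist_le[OF x', of 0 "nat (- k)"]
    by (cases "0 \<le> k") auto
  finally have "L * N < L * \<bar>k\<bar>" by simp
  then have "int N < \<bar>k\<bar>"
    using quasi_line_nonneg[OF x(1)] by (smt (verit) mult_left_mono of_int_of_nat_eq of_int_le_iff)
  then have "N1 \<le> nat k \<and> 0 \<le> k \<or> N2 \<le> nat (- k) \<and> k < 0" by (auto simp: N_def)
  moreover have "N1 \<le> i" "N2 \<le> i" by (auto simp: i_def N_def)
  ultimately show False using N1[of i "nat k"] N2[of i "nat (- k)"] k by auto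
qed

end

section \<open>Isometric actions\<close>

lemma (in group) inv_mult_cancel_left:
  assumes "x \<in> carrier G" "y \<in> carrier G"
  shows "inv x \<otimes> (x \<otimes> y) = y" "x \<otimes> (inv x \<otimes> y) = y"
  using assms by (simp_all add: m_assoc[symmetric])

lemma (in group) conjugate_int_pow:
  assumes g: "g \<in> carrier G" and x: "x \<in> carrier G"
  shows "g \<otimes> x [^] (k::int) \<otimes> inv g = (g \<otimes> x \<otimes> inv g) [^] k"
proof -
  have "(\<lambda>x. g \<otimes> x \<otimes> inv g) \<in> hom G G"
    using g by (auto simp: hom_def m_assoc inv_mult_cancel_left)
  then have "group_hom G G (\<lambda>x. g \<otimes> x \<otimes> inv g)"
    by (simp add: group_hom_def group_hom_axioms_def is_group)
  from group_hom.hom_int_pow[OF this x] show ?thesis by simp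
qed

locale hyperbolic_action = gromov_hyperbolic M d \<delta> for M :: "'s set" and d and \<delta> +
  fixes G (structure) and \<phi> :: "'g \<Rightarrow> 's \<Rightarrow> 's"
  assumes action: "isometric_action G M d \<phi>"
begin

lemma is_group: "group G"
  using action unfolding isometric_action_def group_action_def group_hom_def by blast

interpretation group_action G M \<phi>
  using action by (simp add: isometric_action_def)

interpretation group G by (rule is_group)

lemma act_closed: "g \<in> carrier G \<Longrightarrow> x \<in> M \<Longrightarrow> \<phi> g x \<in> M"
  using element_image by blast

lemma act_mult: "g \<in> carrier G \<Longrightarrow> h \<in> carrier G \<Longrightarrow> x \<in> M \<Longrightarrow> \<phi> (g \<otimes> h) x = \<phi> g (\<phi> h x)"
  by (rule composition_rule)

lemma act_one: "x \<in> M \<Longrightarrow> \<phi> \<one> x = x"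
  using id_eq_one by (metis restrict_apply')

lemma act_inv: "g \<in> carrier G \<Longrightarrow> x \<in> M \<Longrightarrow> \<phi> (inv g) (\<phi> g x) = x"
  using orbit_sym_aux by blast

lemma act_inv': "g \<in> carrier G \<Longrightarrow> x \<in> M \<Longrightarrow> \<phi> g (\<phi> (inv g) x) = x"
  using act_inv[of "inv g" x] by simp

lemma dist_act:
  "g \<in> carrier G \<Longrightarrow> x \<in> M \<Longrightarrow> y \<in> M \<Longrightarrow> d (\<phi> g x) (\<phi> g y) = d x y"
  using action by (simp add: isometric_action_def)

lemma dist_act_inv:
  "g \<in> carrier G \<Longrightarrow> x \<in> M \<Longrightarrow> y \<in> M \<Longrightarrow> d (\<phi> (inv g) x) y = d x (\<phi> g y)"
  using dist_act[of g "\<phi> (inv g) x" y] by (simp add: act_inv' act_closed)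

lemma gp_act:
  "\<lbrakk>g \<in> carrier G; p \<in> M; x \<in> M; y \<in> M\<rbrakk> \<Longrightarrow> gp (\<phi> g p) (\<phi> g x) (\<phi> g y) = gp p x y"
  by (simp add: gromov_product_def dist_act)

lemma quasi_line_act:
  "quasi_line M d b c L x \<Longrightarrow> g \<in> carrier G \<Longrightarrow> quasi_line M d b c L (\<lambda>i. \<phi> g (x i))"
  unfolding quasi_line_def by (auto simp: dist_act gp_act act_closed image_subset_iff)

text \<open>All corners of the path through the points \<open>f [^] i\<close> applied to
  \<open>p\<close> are translates of one another and have product exactly \<open>a\<close>;
  \<open>lox\<close> says that \<open>2 * a + 4 * \<delta> < L\<close>, so
  \<open>local_quasi_line\<close> applies.\<close>

lemma quasi_line_orbit:
  assumes f: "f \<in> carrier G" and p: "p \<in> M"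
    and lox: "d p (\<phi> f p) + 4 * \<delta> < d p (\<phi> (f \<otimes> f) p)"
  shows "\<exists>b c L. 0 < c \<and> quasi_line M d b c L (\<lambda>i::int. \<phi> (f [^] i) p)"
proof -
  define L where "L = d p (\<phi> f p)"
  define a where "a = L - d p (\<phi> (f \<otimes> f) p) / 2"
  define x where "x i = \<phi> (f [^] i) p" for i :: int
  have pow: "f [^] (i + 1) = f [^] i \<otimes> f" for i :: int
    using f by (simp add: int_pow_mult)
  have M: "x i \<in> M" for i using f p by (simp add: x_def act_closed)
  have 1: "x (i + 1) = \<phi> (f [^] i) (\<phi> f p)" for i
    unfolding x_def pow using f p by (simp add: act_mult)
  have step: "d (x i) (x (i + 1)) = L" for i
    unfolding 1 using f p by (simp add: x_def L_def dist_act act_closed)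
  have "f [^] (i + 1) = f [^] (i - 1) \<otimes> (f \<otimes> f)" for i :: int
    using pow[of i] pow[of "i - 1"] f by (simp add: m_assoc)
  then have 2: "x (i + 1) = \<phi> (f [^] (i - 1)) (\<phi> (f \<otimes> f) p)" for i
    using f p unfolding x_def by (simp add: act_mult)
  have "d (x (i - 1)) (x (i + 1)) = d p (\<phi> (f \<otimes> f) p)" for i
    unfolding 2 using f p by (simp add: x_def dist_act act_closed)
  then have "gp (x i) (x (i - 1)) (x (i + 1)) \<le> a" for i
    using step[of i] step[of "i - 1"] two_gromov_product[of "x i" "x (i - 1)" "x (i + 1)"]
      commute[of "x i" "x (i - 1)"] by (simp add: a_def)
  moreover have "2 * a + 3 * \<delta> < L"
    using lox delta_nonneg by (simp add: a_def L_def)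
  ultimately have "quasi_line M d (a + 2 * \<delta>) (L - 2 * a - 2 * \<delta>) L x"
    using local_quasi_line[of x L a] M step by blast
  moreover have "0 < L - 2 * a - 2 * \<delta>"
    using lox delta_nonneg by (simp add: a_def L_def)
  ultimately show ?thesis unfolding x_def by blast
qed

text \<open>Stated for an arbitrary set \<open>A\<close>, so that it can be applied to hand-picked
  elements. Finiteness is separate because \<open>card\<close> of an infinite set is
  \<open>0\<close>.\<close>

lemma acylindricalD:
  assumes "acylindrical_action G M d \<phi>" "0 < \<epsilon>"
  obtains R and N :: nat where "0 < R"
    "\<And>x y A. \<lbrakk>x \<in> M; y \<in> M; R \<le> d x y; A \<subseteq> carrier G;
        \<And>g. g \<in> A \<Longrightarrow> d x (\<phi> g x) \<le> \<epsilon>; \<And>g. g \<in> A \<Longrightarrow> d y (\<phi> g y) \<le> \<epsilon>\<rbrakk>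
        \<Longrightarrow> finite A \<and> card A \<le> N"
proof -
  obtain R and N :: nat where "R > 0"
    and RN: "\<forall>x\<in>M. \<forall>y\<in>M. d x y \<ge> R \<longrightarrow>
        finite {g\<in>carrier G. d x (\<phi> g x) \<le> \<epsilon> \<and> d y (\<phi> g y) \<le> \<epsilon>} \<and>
        card {g\<in>carrier G. d x (\<phi> g x) \<le> \<epsilon> \<and> d y (\<phi> g y) \<le> \<epsilon>} \<le> N"
    using assms unfolding acylindrical_action_def by meson
  show ?thesis
  proof (rule that[OF \<open>R > 0\<close>])
    fix x y A
    assume "x \<in> M" "y \<in> M" "R \<le> d x y" and A: "A \<subseteq> carrier G"
      "\<And>g. g \<in> A \<Longrightarrow> d x (\<phi> g x) \<le> \<epsilon>" "\<And>g. g \<in> A \<Longrightarrow> d y (\<phi> g y) \<le> \<epsilon>"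
    define S where "S = {g\<in>carrier G. d x (\<phi> g x) \<le> \<epsilon> \<and> d y (\<phi> g y) \<le> \<epsilon>}"
    have S: "finite S" "card S \<le> N"
      using RN \<open>x \<in> M\<close> \<open>y \<in> M\<close> \<open>R \<le> d x y\<close> unfolding S_def by auto
    have "A \<subseteq> S" using A by (auto simp: S_def)
    with S show "finite A \<and> card A \<le> N"
      using finite_subset[of A S] card_mono[of S A] by simp
  qed
qed

section \<open>Subgroups without loxodromic elements\<close>

text \<open>The powers of an element violating this inequality move \<open>p\<close> along a quasi-line, so such
  an element is loxodromic.\<close>
definition nonloxodromic :: "'g set \<Rightarrow> bool" where
  "nonloxodromic H \<longleftrightarrow> (\<forall>h\<in>H. \<forall>p\<in>M. d p (\<phi> (h \<otimes> h) p) \<le> d p (\<phi> h p) + 4 * \<delta>)"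

context
  fixes H
  assumes H: "subgroup H G" and nonlox: "nonloxodromic H"
begin

lemmas H_carrier = subgroup.mem_carrier[OF H]

text \<open>The distance between the images of \<open>p\<close> under \<open>h\<close> and
  \<open>inv h\<close> is the displacement of \<open>p\<close> under \<open>h \<otimes> h\<close>,
  which exceeds that under \<open>h\<close> by at most \<open>4 * \<delta>\<close>.\<close>

lemma self_product:
  assumes h: "h \<in> H" and p: "p \<in> M"
  shows "d p (\<phi> h p) / 2 - 2 * \<delta> \<le> gp p (\<phi> h p) (\<phi> (inv h) p)"
proof -
  have hG: "h \<in> carrier G" using h by (rule H_carrier)
  have "d (\<phi> h p) (\<phi> (inv h) p) = d p (\<phi> (h \<otimes> h) p)"
    using dist_act_inv[OF hG p, of "\<phi> h p"] hG p
    by (simp add: act_mult act_closed commute)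
  moreover have "d p (\<phi> (inv h) p) = d p (\<phi> h p)"
    using dist_act_inv[OF hG p p] by (simp add: commute)
  moreover have "d p (\<phi> (h \<otimes> h) p) \<le> d p (\<phi> h p) + 4 * \<delta>"
    using nonlox h p by (simp add: nonloxodromic_def)
  ultimately show ?thesis
    using two_gromov_product[of p "\<phi> h p" "\<phi> (inv h) p"] by simp
qed

text \<open>Suppose the product \<open>?a\<close> is small. Then the images of \<open>p\<close>
  under \<open>inv f\<close>, \<open>f\<close>, \<open>f \<otimes> g\<close>,
  \<open>inv (f \<otimes> g)\<close>, \<open>inv g\<close>, \<open>g\<close> form a chain in which
  neighbours have product at least \<open>t\<close>. Four uses of the four-point inequality give
  \<open>t - 4 * \<delta> \<le> ?a\<close>, a contradiction.\<close>

lemma inv_product: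
  assumes f: "f \<in> H" and g: "g \<in> H" and p: "p \<in> M"
  shows "min (d p (\<phi> f p)) (d p (\<phi> g p)) / 2 - 6 * \<delta> \<le> gp p (\<phi> (inv f) p) (\<phi> g p)"
    (is "?m / 2 - _ \<le> ?a")
proof (rule ccontr)
  assume "\<not> ?thesis"
  then have a: "?a < ?m / 2 - 6 * \<delta>" by simp
  define t where "t = ?m / 2 - 2 * \<delta>"
  have G: "f \<in> carrier G" "g \<in> carrier G" using f g H_carrier by auto
  have fg: "f \<otimes> g \<in> H" using subgroup.m_closed[OF H f g] .
  have gf: "inv (f \<otimes> g) = inv g \<otimes> inv f" using G by (simp add: inv_mult_group)
  have m: "?m \<le> d p (\<phi> f p)" "?m \<le> d p (\<phi> g p)" by auto
  have 1: "t \<le> gp p (\<phi> (inv f) p) (\<phi> f p)"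
    using self_product[OF f p] m by (simp add: t_def gromov_product_commute)
  have 5: "t \<le> gp p (\<phi> (inv g) p) (\<phi> g p)"
    using self_product[OF g p] m by (simp add: t_def gromov_product_commute)
  have "gp (\<phi> f p) p (\<phi> (f \<otimes> g) p) = ?a"
    using gp_act[of f p "\<phi> (inv f) p" "\<phi> g p"] G p by (simp add: act_inv' act_mult act_closed)
  \<comment> \<open>A small \<open>?a\<close> means little backtracking at the image of
    \<open>p\<close> under \<open>f\<close>, so \<open>f\<close> and \<open>f \<otimes> g\<close>
    move \<open>p\<close> in a common direction; link \<open>4\<close> is the same for the
    inverses.\<close>
  then have 2: "t \<le> gp p (\<phi> f p) (\<phi> (f \<otimes> g) p)"
    using gromov_product_swap[of p "\<phi> f p" "\<phi> (f \<otimes> g) p"] m(1) a delta_nonneg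
    unfolding t_def by simp
  have "gp (\<phi> (inv g) p) p (\<phi> (inv (f \<otimes> g)) p) = gp p (\<phi> g p) (\<phi> (inv f) p)"
    unfolding gf using gp_act[of "inv g" p "\<phi> g p" "\<phi> (inv f) p"] G p
    by (simp add: act_inv act_mult act_closed)
  moreover have "d p (\<phi> (inv g) p) = d p (\<phi> g p)"
    using dist_act_inv[OF G(2) p p] by (simp add: commute)
  ultimately have 4: "t \<le> gp p (\<phi> (inv (f \<otimes> g)) p) (\<phi> (inv g) p)"
    using gromov_product_swap[of p "\<phi> (inv g) p" "\<phi> (inv (f \<otimes> g)) p"] m(2) a delta_nonneg
      gromov_product_commute
    unfolding t_def by simp
  have "d p (\<phi> (f \<otimes> g) p) = d (\<phi> (inv f) p) (\<phi> g p)"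
    using dist_act_inv[OF G(1) p, of "\<phi> g p"] G p by (simp add: act_mult act_closed)
  then have "d p (\<phi> (f \<otimes> g) p) = d p (\<phi> f p) + d p (\<phi> g p) - 2 * ?a"
    using two_gromov_product[of p "\<phi> (inv f) p" "\<phi> g p"] dist_act_inv[OF G(1) p p]
    by (simp add: commute)
  \<comment> \<open>With little cancellation \<open>f \<otimes> g\<close> displaces \<open>p\<close>
    far, so \<open>self_product\<close> for \<open>f \<otimes> g\<close> yields at least
    \<open>t\<close>.\<close>
  then have 3: "t \<le> gp p (\<phi> (f \<otimes> g) p) (\<phi> (inv (f \<otimes> g)) p)"
    using self_product[OF fg p] m a delta_nonneg unfolding t_def by linarith
  have M: "\<phi> f p \<in> M" "\<phi> g p \<in> M" "\<phi> (inv f) p \<in> M" "\<phi> (inv g) p \<in> M"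
    "\<phi> (f \<otimes> g) p \<in> M" "\<phi> (inv (f \<otimes> g)) p \<in> M"
    using G p by (auto intro!: act_closed)
  have "t - \<delta> \<le> gp p (\<phi> (inv f) p) (\<phi> (f \<otimes> g) p)"
    using four_point[OF p M(3,1,5)] 1 2 by linarith
  then have "t - 2 * \<delta> \<le> gp p (\<phi> (inv f) p) (\<phi> (inv (f \<otimes> g)) p)"
    using four_point[OF p M(3,5,6)] 3 delta_nonneg by linarith
  then have "t - 3 * \<delta> \<le> gp p (\<phi> (inv f) p) (\<phi> (inv g) p)"
    using four_point[OF p M(3,6,4)] 4 delta_nonneg by linarith
  then have "t - 4 * \<delta> \<le> ?a"
    using four_point[OF p M(3,4,2)] 5 delta_nonneg by linarith
  with a show False by (simp add: t_def)
qed

lemma orbit_product: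
  assumes f: "f \<in> H" and g: "g \<in> H" and p: "p \<in> M"
  shows "min (d p (\<phi> f p)) (d p (\<phi> g p)) / 2 - 6 * \<delta> \<le> gp p (\<phi> f p) (\<phi> g p)"
  using inv_product[OF subgroup.m_inv_closed[OF H f] g p] dist_act_inv[OF H_carrier[OF f] p p]
    H_carrier[OF f] by (simp add: commute)

text \<open>\<open>f\<close> maps \<open>x\<close> onto a geodesic between the images of
  \<open>p\<close> and \<open>w\<close>. The former is within \<open>T\<close> of \<open>p\<close>,
  and the latter is a far orbit point and so lies in the direction of \<open>w\<close>. As
  \<open>x\<close> is deeper than \<open>T\<close> but well before the middle, its image is still
  near a geodesic from \<open>p\<close> to \<open>w\<close>.\<close>

lemma translate_near_geodesic:
  assumes f: "f \<in> H" and h: "h \<in> H" and p: "p \<in> M" and x: "x \<in> M"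
    and w: "w = \<phi> h p" and xw: "d p x + d x w = d p w"
    and T: "d p (\<phi> f p) \<le> T" "T + \<delta> < d p x" "2 * d p x + 3 * T + 10 * \<delta> \<le> d p w"
  shows "gp (\<phi> f x) p w \<le> 2 * \<delta>"
proof -
  have G: "f \<in> carrier G" "h \<in> carrier G" using f h H_carrier by auto
  have M: "\<phi> f x \<in> M" "w \<in> M" "\<phi> f w \<in> M" "\<phi> f p \<in> M"
    using G p x w by (auto intro!: act_closed)
  have fw: "\<phi> f w = \<phi> (f \<otimes> h) p" using G p w by (simp add: act_mult)
  have "d p w \<le> T + d p (\<phi> f w)"
    using triangle'[of "\<phi> f p" p "\<phi> f w"] dist_act[OF G(1) p M(2)] T(1) M p
    by (simp add: commute)
  moreover have "0 \<le> T" using nonneg[of p "\<phi> f p"] T(1) by linarith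
  ultimately have "d p w - T \<le> min (d p (\<phi> f w)) (d p w)" by simp
  then have "(d p w - T) / 2 \<le> min (d p (\<phi> f w)) (d p w) / 2"
    by (rule divide_right_mono) simp
  then have pw: "(d p w - T) / 2 - 6 * \<delta> \<le> gp p (\<phi> f w) w"
    using orbit_product[OF subgroup.m_closed[OF H f h] h p]
    unfolding fw[symmetric] w[symmetric] by (meson diff_right_mono order_trans)
  have "gp (\<phi> f x) (\<phi> f p) (\<phi> f w) = 0"
    using gp_act[OF G(1) x p M(2)] two_gromov_product[of x p w] xw by (simp add: commute)
  moreover have "\<delta> < gp (\<phi> f x) (\<phi> f p) p"
    using gromov_product_ge[OF M(1,4) p] dist_act[OF G(1) x p] T by (simp add: commute)
  ultimately have 1: "gp (\<phi> f x) p (\<phi> f w) \<le> \<delta>"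
    using four_point[OF M(1,4) p M(3)] by (auto simp: min_def split: if_splits)
  have "d p (\<phi> f x) \<le> d p x + T"
    using triangle[OF p M(4,1)] dist_act[OF G(1) p x] T by simp
  then have "d p (\<phi> f x) - \<delta> \<le> gp p (\<phi> f w) w"
    using pw T(3) by argo
  moreover have "d p (\<phi> f x) - \<delta> \<le> gp p (\<phi> f x) (\<phi> f w)"
    using 1 gromov_product_swap[of p "\<phi> f x" "\<phi> f w"] by simp
  ultimately have "d p (\<phi> f x) - 2 * \<delta> \<le> gp p (\<phi> f x) w"
    using four_point[OF p M(1,3,2)] by linarith
  then show ?thesis using gromov_product_swap[of p "\<phi> f x" w] by simp
qed

text \<open>The bound is independent of \<open>T\<close>. Near the geodesic \<open>f\<close> acts as
  a shift by about \<open>\<bar>d p x - s\<bar>\<close>, and a large shift would make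
  \<open>f \<otimes> f\<close> shift twice as far, against \<open>nonloxodromic\<close>.\<close>

lemma displacement_bound:
  assumes f: "f \<in> H" and h: "h \<in> H" and p: "p \<in> M" and x: "x \<in> M"
    and w: "w = \<phi> h p" and xw: "d p x + d x w = d p w"
    and T: "d p (\<phi> f p) \<le> T" "T + 4 * \<delta> < d p x" "2 * d p x + 3 * T + 10 * \<delta> \<le> d p w"
  shows "d x (\<phi> f x) \<le> 18 * \<delta>"
proof -
  have G: "f \<in> carrier G" "inv f \<in> carrier G" "h \<in> carrier G" using f h H_carrier by auto
  have M: "\<phi> f x \<in> M" "w \<in> M" "\<phi> (inv f) x \<in> M" "\<phi> f p \<in> M"
    using G p x w by (auto intro!: act_closed)
  have T': "d p (\<phi> (inv f) p) \<le> T"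
    using dist_act_inv[OF G(1) p p] T(1) by (simp add: commute)
  have T2: "T + \<delta> < d p x" using T(2) delta_nonneg by linarith
  have near: "gp (\<phi> f x) p w \<le> 2 * \<delta>" "gp x p w \<le> 2 * \<delta>"
    using translate_near_geodesic[OF f h p x w xw T(1) T2 T(3)]
      two_gromov_product[of x p w] xw delta_nonneg by (simp_all add: commute)
  define e where "e = d x (\<phi> f x)"
  define s where "s = d p (\<phi> f x)"
  define s' where "s' = d p (\<phi> (inv f) x)"
  have e: "e \<le> \<bar>d p x - s\<bar> + 6 * \<delta>"
    using dist_le_of_near_geodesic[OF x M(1) p M(2) near(2,1)] by (simp add: e_def s_def)
  have sT: "\<bar>d p x - s\<bar> \<le> T"
    using triangle[OF p M(4,1)] triangle[OF M(4) p M(1)] dist_act[OF G(1) p x] T(1)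
    by (simp add: s_def commute abs_le_iff)
  have fpx: "d (\<phi> f p) x = s'"
    using dist_act_inv[OF G(1) x p] by (simp add: s'_def commute)
  have "2 * d p x \<le> max (s + s') (d p (\<phi> f p) + e) + 2 * \<delta>"
    using four_point_dist[OF p x M(1,4)] dist_act[OF G(1) x p] fpx
    by (simp add: s_def e_def commute add.commute)
  moreover have "s + s' \<le> max (2 * d p x) (d p (\<phi> f p) + e) + 2 * \<delta>"
    using four_point_dist[OF p M(1) x M(4)] dist_act[OF G(1) x p] fpx
    by (simp add: s_def e_def commute add.commute)
  moreover have "d p (\<phi> f p) + e \<le> 2 * T + 6 * \<delta>" using e sT T(1) by linarith
  \<comment> \<open>Since \<open>T + 4 * \<delta> < d p x\<close>, the third sum
    \<open>d p (\<phi> f p) + e\<close> is too small to be the maximum, so the other two sums nearly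
    agree.\<close>
  ultimately have mid: "\<bar>s + s' - 2 * d p x\<bar> \<le> 2 * \<delta>"
    using T(2) delta_nonneg by (auto simp: max_def split: if_splits)
  have "\<bar>s - s'\<bar> \<le> d (\<phi> f x) (\<phi> (inv f) x)"
    using triangle[OF p M(1,3)] triangle[OF p M(3,1)]
    by (simp add: s_def s'_def commute abs_le_iff)
  also have "\<dots> = d x (\<phi> (f \<otimes> f) x)"
    using dist_act_inv[OF G(1) x M(1)] G x by (simp add: act_mult commute)
  also have "\<dots> \<le> e + 4 * \<delta>" using nonlox f x by (simp add: nonloxodromic_def e_def)
  finally have "\<bar>s - s'\<bar> \<le> e + 4 * \<delta>" .
  \<comment> \<open>Halving the last two estimates gives
    \<open>\<bar>d p x - s\<bar> \<le> e / 2 + 3 * \<delta>\<close>, hence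
    \<open>e \<le> e / 2 + 9 * \<delta>\<close>.\<close>
  with e mid show ?thesis unfolding e_def[symmetric] by (simp add: abs_if split: if_splits)
qed

lemma nonloxodromic_bounded:
  assumes acyl: "acylindrical_action G M d \<phi>" and inf: "infinite H" and p: "p \<in> M"
  shows "\<exists>B. \<forall>h\<in>H. d p (\<phi> h p) \<le> B"
proof (rule ccontr)
  assume unb: "\<not> ?thesis"
  \<comment> \<open>The added \<open>1\<close> makes the bound positive even when \<delta> is
    \<open>0\<close>.\<close>
  have "0 < 18 * \<delta> + 1" using delta_nonneg by simp
  from acylindricalD[OF acyl this] obtain R and N :: nat where "0 < R" and RN:
    "\<And>x y A. \<lbrakk>x \<in> M; y \<in> M; R \<le> d x y; A \<subseteq> carrier G;
        \<And>g. g \<in> A \<Longrightarrow> d x (\<phi> g x) \<le> 18 * \<delta> + 1; \<And>g. g \<in> A \<Longrightarrow> d y (\<phi> g y) \<le> 18 * \<delta> + 1\<rbrakk>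
        \<Longrightarrow> finite A \<and> card A \<le> N"
    by metis
  obtain F where F: "F \<subseteq> H" "finite F" "card F = N + 1"
    using infinite_arbitrarily_large[OF inf] by blast
  define T where "T = Max ((\<lambda>f. d p (\<phi> f p)) ` F)"
  have T: "d p (\<phi> f p) \<le> T" if "f \<in> F" for f using F(2) that by (simp add: T_def)
  have "F \<noteq> {}" using F(3) by auto
  then have "0 \<le> T" using T nonneg order_trans by blast
  define t where "t = T + 4 * \<delta> + 1"
  \<comment> \<open>Chosen after \<open>F\<close> and \<open>T\<close>, so that both depths
    \<open>t\<close> and \<open>t + R\<close> satisfy the hypotheses of
    \<open>displacement_bound\<close> for every element of \<open>F\<close>.\<close>
  obtain h where h: "h \<in> H" and hT: "2 * (t + R) + 3 * T + 10 * \<delta> < d p (\<phi> h p)"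
    using unb by (meson not_le_imp_less)
  define w where "w = \<phi> h p"
  have w: "w \<in> M" using h p H_carrier by (simp add: w_def act_closed)
  have tR: "0 \<le> t" "t \<le> d p w" "0 \<le> t + R" "t + R \<le> d p w"
    using hT \<open>0 \<le> T\<close> \<open>0 < R\<close> delta_nonneg by (auto simp: w_def t_def)
  obtain x where x: "x \<in> M" "d p x = t" "d x w = d p w - t"
    using interpolation[OF p w tR(1,2)] by blast
  obtain y where y: "y \<in> M" "d p y = t + R" "d y w = d p w - (t + R)"
    using interpolation[OF p w tR(3,4)] by blast
  have "d x (\<phi> f x) \<le> 18 * \<delta> + 1" "d y (\<phi> f y) \<le> 18 * \<delta> + 1" if "f \<in> F" for f
  proof -
    have fH: "f \<in> H" using F(1) that by blast
    show "d x (\<phi> f x) \<le> 18 * \<delta> + 1"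
      using displacement_bound[OF fH h p x(1) w_def _ T[OF that]] x hT \<open>0 < R\<close>
      by (simp add: t_def w_def)
    show "d y (\<phi> f y) \<le> 18 * \<delta> + 1"
      using displacement_bound[OF fH h p y(1) w_def _ T[OF that]] y hT \<open>0 < R\<close>
      by (simp add: t_def w_def)
  qed
  moreover have "R \<le> d x y" using triangle[OF p x(1) y(1)] x y by simp
  moreover have "F \<subseteq> carrier G" using F(1) H_carrier by blast
  ultimately have "card F \<le> N" using RN[OF x(1) y(1)] by blast
  with F(3) show False by simp
qed

end

end

context hyperbolic_action
begin

interpretation group_action G M \<phi>
  using action by (simp add: isometric_action_def)

interpretation group G by (rule is_group)

section \<open>s-normal subgroups with bounded orbits\<close>

text \<open>Membership of \<open>k\<close> in \<open>inv g <# H #> g\<close> is expressed through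
  its conjugate, the form used in the displacement estimates.\<close>

lemma s_normal_infinite:
  assumes "s_normal H G" and g: "g \<in> carrier G"
  shows "infinite {k \<in> H. g \<otimes> k \<otimes> inv g \<in> H}"
proof
  assume fin: "finite {k \<in> H. g \<otimes> k \<otimes> inv g \<in> H}"
  have H: "H \<subseteq> carrier G" using assms subgroup.subset unfolding s_normal_def by blast
  have "(inv g <# H #> g) \<inter> H \<subseteq> {k \<in> H. g \<otimes> k \<otimes> inv g \<in> H}"
  proof
    fix k assume k: "k \<in> (inv g <# H #> g) \<inter> H"
    then obtain h where h: "h \<in> H" "k = inv g \<otimes> h \<otimes> g"
      by (auto simp: l_coset_def r_coset_def)
    then have "h \<in> carrier G" using H by blast
    then have "g \<otimes> k \<otimes> inv g = h"
      unfolding h(2) using g by (simp add: m_assoc inv_mult_cancel_left)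
    with k h show "k \<in> {k \<in> H. g \<otimes> k \<otimes> inv g \<in> H}" by simp
  qed
  then have "finite ((inv g <# H #> g) \<inter> H)" using fin finite_subset by blast
  with assms show False unfolding s_normal_def by blast
qed

text \<open>Conjugation turns the displacement of \<open>\<phi> (inv g) p\<close> under
  \<open>k\<close> into that of \<open>p\<close> under an element of \<open>H\<close>. The threshold
  \<open>R\<close> comes from acylindricity alone and serves all \<open>g\<close> at once.\<close>

lemma s_normal_bounded:
  assumes acyl: "acylindrical_action G M d \<phi>" and sn: "s_normal H G" and p: "p \<in> M"
    and B: "\<And>h. h \<in> H \<Longrightarrow> d p (\<phi> h p) \<le> B"
  shows "\<exists>R. \<forall>g\<in>carrier G. d p (\<phi> g p) \<le> R"
proof -
  have H: "subgroup H G" using sn by (simp add: s_normal_def)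
  have "0 \<le> B" using order_trans[OF nonneg B[OF subgroup.one_closed[OF H]]] .
  then have "0 < B + 1" by simp
  from acylindricalD[OF acyl this] obtain R and N :: nat where RN:
    "\<And>x y A. \<lbrakk>x \<in> M; y \<in> M; R \<le> d x y; A \<subseteq> carrier G;
        \<And>g. g \<in> A \<Longrightarrow> d x (\<phi> g x) \<le> B + 1; \<And>g. g \<in> A \<Longrightarrow> d y (\<phi> g y) \<le> B + 1\<rbrakk>
        \<Longrightarrow> finite A \<and> card A \<le> N"
    by metis
  have "d p (\<phi> g p) \<le> R" if g: "g \<in> carrier G" for g
  proof (rule ccontr)
    assume "\<not> ?thesis"
    then have far: "R \<le> d p (\<phi> (inv g) p)"
      using dist_act_inv[OF g p p] by (simp add: commute)
    define A where "A = {k \<in> H. g \<otimes> k \<otimes> inv g \<in> H}"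
    have y: "\<phi> (inv g) p \<in> M" using g p by (simp add: act_closed)
    have AG: "A \<subseteq> carrier G" using subgroup.subset[OF H] by (auto simp: A_def)
    have "d p (\<phi> k p) \<le> B + 1" if "k \<in> A" for k
      using B[of k] that by (simp add: A_def)
    moreover have "d (\<phi> (inv g) p) (\<phi> k (\<phi> (inv g) p)) \<le> B + 1" if "k \<in> A" for k
    proof -
      have k: "k \<in> carrier G" "g \<otimes> k \<otimes> inv g \<in> H" using that AG by (auto simp: A_def)
      have "d (\<phi> (inv g) p) (\<phi> k (\<phi> (inv g) p)) = d p (\<phi> (g \<otimes> k \<otimes> inv g) p)"
        using dist_act_inv[OF g p, of "\<phi> k (\<phi> (inv g) p)"] g k p
        by (simp add: act_mult act_closed)
      then show ?thesis using B[OF k(2)] by simp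
    qed
    ultimately have "finite A" using RN[OF p y far AG] by blast
    then show False using s_normal_infinite[OF sn g] by (simp add: A_def)
  qed
  then show ?thesis by blast
qed

lemma limit_set_bounded:
  assumes p: "p \<in> M" and R: "\<And>g. g \<in> carrier G \<Longrightarrow> d p (\<phi> g p) \<le> R"
  shows "limit_set G M d \<phi> = {}"
proof (rule ccontr)
  assume "limit_set G M d \<phi> \<noteq> {}"
  then obtain q \<xi> u where q: "q \<in> M" and \<xi>: "\<xi> \<in> gromov_boundary M d" "u \<in> \<xi>"
    and u: "range u \<subseteq> orbit G \<phi> q"
    unfolding limit_set_def accumulation_points_def by blast
  have "u \<in> converging_at_infinity M d"
    using \<xi> by (auto simp: gromov_boundary_def quotient_def boundary_rel_def)
  then obtain i where i: "R + d p q + 1 \<le> d p (u i)"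
    using converging_dist_at_infinity[OF _ p] by blast
  obtain g where g: "g \<in> carrier G" "u i = \<phi> g q" using u by (auto simp: orbit_def)
  have "d p (u i) \<le> d p (\<phi> g p) + d (\<phi> g p) (\<phi> g q)"
    unfolding g(2) using triangle[of p "\<phi> g p" "\<phi> g q"] g p q by (simp add: act_closed)
  then show False using i R[OF g(1)] dist_act[OF g(1) p q] by simp
qed

end

section \<open>Subgroups with a loxodromic element\<close>

locale loxodromic_subgroup = hyperbolic_action +
  fixes H f p b c L
  assumes acyl: "acylindrical_action G M d \<phi>"
    and H: "subgroup H G" and f: "f \<in> H" and p: "p \<in> M"
    and c: "0 < c" and line: "quasi_line M d b c L (\<lambda>i::int. \<phi> (f [^]\<^bsub>G\<^esub> i) p)"
    and elementary: "elementary_action (G\<lparr>carrier := H\<rparr>) M d \<phi>"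
begin

interpretation group_action G M \<phi>
  using action by (simp add: isometric_action_def)

interpretation group G by (rule is_group)

definition "orb i = \<phi> (f [^] (i::int)) p"

text \<open>The distance between two quasi-lines provided by
  \<open>quasi_lines_close\<close>.\<close>

definition "width = L + 4 * b + 10 * \<delta>"

lemma quasi_line_orb: "quasi_line M d b c L orb"
  using line unfolding orb_def .

lemma f_carrier: "f \<in> carrier G"
  using subgroup.mem_carrier[OF H f] .

lemmas mem_carrier = subgroup.mem_carrier[OF H]

lemma pow_mem: "f [^] (i::int) \<in> H"
  using group.int_pow_closed[OF subgroup.subgroup_is_group[OF H is_group], of f i]
    int_pow_consistent[OF H f] f by simp

lemma orb_0: "orb 0 = p"
  using p by (simp add: orb_def act_one)

lemma act_orb: "g \<in> carrier G \<Longrightarrow> \<phi> g (orb i) = \<phi> (g \<otimes> f [^] i) p"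
  using f_carrier p by (simp add: orb_def act_mult)

abbreviation "orb_pos \<equiv> \<lambda>n. orb (int n)"
abbreviation "orb_neg \<equiv> \<lambda>n. orb (- int n)"

lemma orb_ends:
  "orb_pos \<in> converging_at_infinity M d" "orb_neg \<in> converging_at_infinity M d"
  using quasi_line_converging[OF quasi_line_orb c]
    quasi_line_converging[OF quasi_line_reverse[OF quasi_line_orb] c]
  by auto

text \<open>The two ends of the quasi-line are distinct limit points of \<open>H\<close>, so they
  exhaust a limit set of at most two points.\<close>

lemma orbit_sequence_limit:
  assumes u: "u \<in> converging_at_infinity M d" and "range u \<subseteq> (\<lambda>h. \<phi> h p) ` H"
  shows "(u, orb_pos) \<in> boundary_rel M d \<or> (u, orb_neg) \<in> boundary_rel M d"
proof -
  define \<Lambda> where "\<Lambda> = limit_set (G\<lparr>carrier := H\<rparr>) M d \<phi>"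
  define cls where "cls v = boundary_rel M d `` {v}" for v
  have mem: "cls v \<in> \<Lambda>"
    if v: "v \<in> converging_at_infinity M d" "range v \<subseteq> (\<lambda>h. \<phi> h p) ` H" for v
  proof -
    have "cls v \<in> gromov_boundary M d"
      using v(1) by (simp add: gromov_boundary_def quotientI cls_def)
    moreover have "v \<in> cls v"
      using equiv_class_self[OF equiv_boundary_rel v(1)] by (simp add: cls_def)
    moreover have "range v \<subseteq> orbit (G\<lparr>carrier := H\<rparr>) \<phi> p"
      using v(2) by (auto simp: orbit_def)
    ultimately show ?thesis
      using p unfolding \<Lambda>_def limit_set_def accumulation_points_def by blast
  qed
  have "range orb_pos \<subseteq> (\<lambda>h. \<phi> h p) ` H" "range orb_neg \<subseteq> (\<lambda>h. \<phi> h p) ` H"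
    using pow_mem by (auto simp: orb_def)
  then have sub: "{cls orb_pos, cls orb_neg, cls u} \<subseteq> \<Lambda>"
    using mem orb_ends assms by simp
  have "cls orb_pos \<noteq> cls orb_neg"
    using quasi_line_ends_distinct[OF quasi_line_orb]
      eq_equiv_class_iff[OF equiv_boundary_rel orb_ends]
    by (simp add: cls_def)
  moreover have "card {cls orb_pos, cls orb_neg, cls u} \<le> 2"
    using elementary card_mono[OF _ sub] unfolding elementary_action_def \<Lambda>_def[symmetric]
    by linarith
  ultimately have "cls u = cls orb_pos \<or> cls u = cls orb_neg"
    by (auto simp: card_insert_if split: if_splits)
  then show ?thesis
    using eq_equiv_class_iff[OF equiv_boundary_rel u] orb_ends by (simp add: cls_def)
qed

text \<open>\<open>h\<close> carries the quasi-line to another one inside the orbit of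
  \<open>H\<close>, whose ends are therefore among those of \<open>orb\<close>. Hence
  \<open>quasi_lines_close\<close> applies at the image of \<open>p\<close>.\<close>

lemma subgroup_orbit_near_orb:
  assumes h: "h \<in> H"
  shows "\<exists>i. d (\<phi> h p) (orb i) \<le> width"
proof -
  have hG: "h \<in> carrier G" using h by (rule mem_carrier)
  define y where "y i = \<phi> h (orb i)" for i
  have y: "quasi_line M d b c L y"
    unfolding y_def using quasi_line_act[OF quasi_line_orb hG] .
  have y0: "y 0 = \<phi> h p" by (simp add: y_def orb_0)
  have y0M: "y 0 \<in> M" using quasi_lineD(1)[OF y] .
  have yH: "y i \<in> (\<lambda>h. \<phi> h p) ` H" for i
    unfolding y_def act_orb[OF hG] using subgroup.m_closed[OF H h pow_mem] by blast
  have large: "\<exists>n m. b + 2 * \<delta> < gp (y 0) (u n) (orb m)"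
    if "u \<in> converging_at_infinity M d" "range u \<subseteq> (\<lambda>h. \<phi> h p) ` H" for u
    using orbit_sequence_limit[OF that] boundary_rel_imp_large_product[OF _ y0M] by blast
  have "(\<lambda>n. y (int n)) \<in> converging_at_infinity M d"
    "(\<lambda>n. y (- int n)) \<in> converging_at_infinity M d"
    using quasi_line_converging[OF y c] quasi_line_converging[OF quasi_line_reverse[OF y] c]
    by auto
  with large[of "\<lambda>n. y (int n)"] large[of "\<lambda>n. y (- int n)"] yH
  obtain n m n' m' where
    "b + 2 * \<delta> < gp (y 0) (y (int n)) (orb m)" "b + 2 * \<delta> < gp (y 0) (y (- int n')) (orb m')"
    by blast
  then show ?thesis
    using quasi_lines_close[OF quasi_line_orb y, of "- int n'" "int n" m' m] y0 by (simp add: width_def)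
qed

text \<open>Contains representatives of all right cosets of \<langle>f\<rangle> in \<open>H\<close>;
  its finiteness is the finite index of \<langle>f\<rangle>.\<close>

definition "near = {h \<in> H. d p (\<phi> h p) \<le> width}"

lemma width_nonneg: "0 \<le> width"
  using quasi_line_nonneg[OF quasi_line_orb] delta_nonneg by (simp add: width_def)

text \<open>Elements of \<open>near\<close> move \<open>p\<close> a bounded amount and send a far
  point \<open>q\<close> of the quasi-line close to one of finitely many points
  \<open>orb i\<close>. Infinitely many share such a point, and their quotients by one of them move
  both \<open>p\<close> and \<open>q\<close> by at most \<open>2 * width\<close>, against
  acylindricity.\<close>

lemma finite_near: "finite near"
proof (rule ccontr)
  assume inf: "infinite near"
  have "0 < 2 * width + 1" using width_nonneg by simp
  from acylindricalD[OF acyl this] obtain R and N :: nat where "0 < R" and RN: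
    "\<And>x y A. \<lbrakk>x \<in> M; y \<in> M; R \<le> d x y; A \<subseteq> carrier G;
        \<And>g. g \<in> A \<Longrightarrow> d x (\<phi> g x) \<le> 2 * width + 1;
        \<And>g. g \<in> A \<Longrightarrow> d y (\<phi> g y) \<le> 2 * width + 1\<rbrakk> \<Longrightarrow> finite A \<and> card A \<le> N"
    by metis
  \<comment> \<open>Since \<open>d p (orb n)\<close> is at least \<open>c * n\<close>, this puts
    \<open>q\<close> beyond the acylindricity threshold \<open>R\<close>.\<close>
  obtain n :: nat where n: "R / c < n" using reals_Archimedean2 by blast
  define q where "q = orb n"
  have q: "q \<in> M" using quasi_lineD(1)[OF quasi_line_orb] by (simp add: q_def)
  have "R \<le> c * n" using n c by (simp add: field_simps)
  then have R: "R \<le> d p q"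
    using quasi_lineD(3)[OF quasi_line_orb, of 0 n] by (simp add: q_def orb_0)
  have nearG: "h \<in> carrier G" "d p (\<phi> h p) \<le> width" if "h \<in> near" for h
    using that mem_carrier by (auto simp: near_def)
  have "\<exists>i. d (\<phi> h q) (orb i) \<le> width" if "h \<in> near" for h
    using subgroup_orbit_near_orb[OF subgroup.m_closed[OF H _ pow_mem]] that
      act_orb[OF nearG(1)[OF that]] by (auto simp: near_def q_def)
  then obtain \<iota> where \<iota>: "\<And>h. h \<in> near \<Longrightarrow> d (\<phi> h q) (orb (\<iota> h)) \<le> width" by metis
  obtain K :: nat where K: "(2 * width + d p q) / c < K" using reals_Archimedean2 by blast
  have "\<iota> h \<in> {- int K..int K}" if h: "h \<in> near" for h
  proof -
    have M: "\<phi> h p \<in> M" "\<phi> h q \<in> M" "orb (\<iota> h) \<in> M"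
      using nearG[OF h] p q quasi_lineD(1)[OF quasi_line_orb] by (auto simp: act_closed)
    have "c * real_of_int \<bar>\<iota> h\<bar> \<le> d p (orb (\<iota> h))"
      using quasi_lineD(3)[OF quasi_line_orb, of 0 "\<iota> h"] by (simp add: orb_0)
    also have "\<dots> \<le> d p (\<phi> h p) + d (\<phi> h p) (\<phi> h q) + d (\<phi> h q) (orb (\<iota> h))"
      using triangle[OF p M(1,3)] triangle[OF M] by linarith
    also have "\<dots> \<le> 2 * width + d p q"
      using nearG[OF h] \<iota>[OF h] dist_act[OF nearG(1)[OF h] p q] by linarith
    also have "\<dots> < c * K" using K c by (simp add: field_simps)
    finally have "real_of_int \<bar>\<iota> h\<bar> < K" using c by simp
    then show ?thesis by auto
  qed
  then have "finite (\<iota> ` near)" using finite_subset[of _ "{- int K..int K}"] by blast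
  from pigeonhole_infinite[OF inf this] obtain h0 where h0: "h0 \<in> near"
    and inf': "infinite {h \<in> near. \<iota> h = \<iota> h0}" by blast
  define A where "A = (\<lambda>h. inv h0 \<otimes> h) ` {h \<in> near. \<iota> h = \<iota> h0}"
  have "inj_on (\<lambda>h. inv h0 \<otimes> h) {h \<in> near. \<iota> h = \<iota> h0}"
    using nearG h0 by (auto intro!: inj_onI)
  then have "infinite A" using inf' by (simp add: A_def finite_image_iff)
  have displ: "d z (\<phi> (inv h0 \<otimes> h) z) = d (\<phi> h0 z) (\<phi> h z)" if "h \<in> near" "z \<in> M" for h z
    using dist_act_inv[of h0 "\<phi> h z" z] nearG[OF h0] nearG[OF that(1)] that
    by (simp add: act_mult act_closed commute)
  have "d p (\<phi> g p) \<le> 2 * width + 1 \<and> d q (\<phi> g q) \<le> 2 * width + 1" if gA: "g \<in> A" for g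
  proof -
    obtain h where h: "h \<in> near" "\<iota> h = \<iota> h0" "g = inv h0 \<otimes> h" using gA unfolding A_def by blast
    have M: "\<phi> h0 p \<in> M" "\<phi> h p \<in> M" "\<phi> h0 q \<in> M" "\<phi> h q \<in> M" "orb (\<iota> h0) \<in> M"
      using nearG(1)[OF h(1)] nearG(1)[OF h0] p q quasi_lineD(1)[OF quasi_line_orb]
      by (auto simp: act_closed)
    have "d p (\<phi> g p) \<le> 2 * width"
      unfolding h(3) displ[OF h(1) p]
      using triangle''[OF M(1) p M(2)] nearG(2)[OF h0] nearG(2)[OF h(1)] by linarith
    moreover have "d q (\<phi> g q) \<le> 2 * width"
      unfolding h(3) displ[OF h(1) q]
      using triangle'[OF M(3,5,4)] \<iota>[OF h0] \<iota>[OF h(1)] h(2) by simp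
    ultimately show ?thesis by simp
  qed
  moreover have "A \<subseteq> carrier G" using nearG h0 by (auto simp: A_def)
  ultimately have "finite A" using RN[OF p q R] by blast
  with \<open>infinite A\<close> show False by blast
qed

lemma near_decomposition:
  assumes h: "h \<in> H"
  shows "\<exists>i::int. \<exists>a\<in>near. h = f [^] i \<otimes> a"
proof -
  have hG: "h \<in> carrier G" using h by (rule mem_carrier)
  obtain i where i: "d (\<phi> h p) (orb i) \<le> width" using subgroup_orbit_near_orb[OF h] by blast
  define a where "a = inv (f [^] i) \<otimes> h"
  have "a \<in> H" unfolding a_def
    using subgroup.m_closed[OF H subgroup.m_inv_closed[OF H pow_mem] h] .
  moreover have "d p (\<phi> a p) = d (\<phi> h p) (orb i)"
    using dist_act_inv[of "f [^] i" "\<phi> h p" p] hG f_carrier p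
    by (simp add: a_def orb_def act_mult act_closed commute)
  ultimately have "a \<in> near" using i by (simp add: near_def)
  moreover have "h = f [^] i \<otimes> a"
    using hG f_carrier by (simp add: a_def m_assoc[symmetric])
  ultimately show ?thesis by blast
qed

text \<open>Since \<open>\<langle>f\<rangle>\<close> has finite index in \<open>H\<close>, an infinite set of \<open>k \<in> H \<inter> H\<^sup>g\<close> contains two
  elements which differ by a power of \<open>f\<close> and whose conjugates do as well.\<close>
lemma power_conjugate:
  assumes sn: "s_normal H G" and g: "g \<in> carrier G"
  shows "\<exists>(m::int) (n::int). m \<noteq> 0 \<and> n \<noteq> 0 \<and> g \<otimes> f [^] m \<otimes> inv g = f [^] n"
proof -
  define K where "K = {k \<in> H. g \<otimes> k \<otimes> inv g \<in> H}"
  have inf: "infinite K" using s_normal_infinite[OF sn g] by (simp add: K_def)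
  obtain I \<alpha> where I: "\<And>h. h \<in> H \<Longrightarrow> \<alpha> h \<in> near \<and> h = f [^] (I h :: int) \<otimes> \<alpha> h"
    using near_decomposition by metis
  \<comment> \<open>Records the coset representatives of \<open>k\<close> and of its conjugate
    simultaneously; it takes finitely many values.\<close>
  define \<psi> where "\<psi> k = (\<alpha> k, \<alpha> (g \<otimes> k \<otimes> inv g))" for k
  have "\<psi> ` K \<subseteq> near \<times> near" using I by (auto simp: \<psi>_def K_def)
  then have "finite (\<psi> ` K)" using finite_near finite_subset by blast
  from pigeonhole_infinite[OF inf this] obtain k0 where k0: "k0 \<in> K"
    and inf': "infinite {k \<in> K. \<psi> k = \<psi> k0}" by blast
  then have "infinite ({k \<in> K. \<psi> k = \<psi> k0} - {k0})" by simp
  then obtain k where "k \<in> {k \<in> K. \<psi> k = \<psi> k0} - {k0}" using infinite_imp_nonempty by blast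
  then have k: "k \<in> K" "\<psi> k = \<psi> k0" "k \<noteq> k0" by auto
  have quot: "h \<otimes> inv h' = f [^] (I h - I h')" if h: "h \<in> H" "h' \<in> H" "\<alpha> h = \<alpha> h'" for h h'
  proof -
    have "\<alpha> h' \<in> carrier G" using I[OF h(2)] mem_carrier by (simp add: near_def)
    moreover have "h = f [^] I h \<otimes> \<alpha> h'" "h' = f [^] I h' \<otimes> \<alpha> h'"
      using I[OF h(1)] I[OF h(2)] h(3) by auto
    ultimately have "h \<otimes> inv h' = f [^] I h \<otimes> \<alpha> h' \<otimes> inv (f [^] I h' \<otimes> \<alpha> h')" by simp
    also have "\<dots> = f [^] I h \<otimes> inv (f [^] I h')"
      using \<open>\<alpha> h' \<in> carrier G\<close> f_carrier by (simp add: inv_mult_group m_assoc inv_mult_cancel_left)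
    also have "\<dots> = f [^] (I h - I h')"
      using \<open>\<alpha> h' \<in> carrier G\<close> f_carrier by (simp add: int_pow_diff)
    finally show ?thesis .
  qed
  define l where "l k = g \<otimes> k \<otimes> inv g" for k
  define m n where "m = I k - I k0" and "n = I (l k) - I (l k0)"
  have mem: "k \<in> H" "k0 \<in> H" "l k \<in> H" "l k0 \<in> H" using k k0 by (auto simp: K_def l_def)
  have G: "k \<in> carrier G" "k0 \<in> carrier G" using mem mem_carrier by auto
  have m: "k \<otimes> inv k0 = f [^] m"
    using quot[OF mem(1,2)] k(2) by (simp add: \<psi>_def m_def)
  have n: "l k \<otimes> inv (l k0) = f [^] n"
    using quot[OF mem(3,4)] k(2) by (simp add: \<psi>_def n_def l_def)
  have "l k \<otimes> inv (l k0) = g \<otimes> (k \<otimes> inv k0) \<otimes> inv g"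
    using G g unfolding l_def by (simp add: inv_mult_group m_assoc inv_mult_cancel_left)
  then have conj: "g \<otimes> f [^] m \<otimes> inv g = f [^] n" using m n by simp
  \<comment> \<open>Distinct \<open>k\<close> and \<open>k0\<close> give a non-trivial quotient,
    which rules out the exponent \<open>0\<close>; conjugation by \<open>g\<close> keeps it
    non-trivial.\<close>
  have neq: "k \<otimes> inv k0 \<noteq> \<one>"
    using k(3) G by (metis inv_inv inv_closed inv_equality)
  then have "m \<noteq> 0" using m by auto
  moreover have "n \<noteq> 0"
  proof
    assume "n = 0"
    then have "g \<otimes> (k \<otimes> inv k0) \<otimes> inv g = \<one>" using conj m by simp
    then have "g \<otimes> (k \<otimes> inv k0) = g \<otimes> \<one>"
      using g G by (metis inv_closed inv_equality inv_inv m_closed r_one)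
    then show False using neq g G by simp
  qed
  ultimately show ?thesis using conj by blast
qed

lemma orbit_near_orb:
  assumes sn: "s_normal H G" and g: "g \<in> carrier G"
  shows "\<exists>i. d (\<phi> g p) (orb i) \<le> width"
proof -
  obtain m n :: int where mn: "m \<noteq> 0" "g \<otimes> f [^] m \<otimes> inv g = f [^] n"
    using power_conjugate[OF sn g] by blast
  define y where "y i = \<phi> g (orb i)" for i
  have y: "quasi_line M d b c L y"
    unfolding y_def using quasi_line_act[OF quasi_line_orb g] .
  have y0: "y 0 = \<phi> g p" by (simp add: y_def orb_0)
  have M: "y i \<in> M" "orb i \<in> M" for i
    using quasi_lineD(1)[OF y] quasi_lineD(1)[OF quasi_line_orb] by auto
  define C where "C = d (\<phi> g p) p"
  \<comment> \<open>Infinitely many points of the translated quasi-line, in both directions, are at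
    the same distance \<open>C\<close> from points of \<open>orb\<close>, since a power of
    \<open>f\<close> carries one such pair to each of the others.\<close>
  have close: "d (y (m * k)) (orb (n * k)) = C" for k
  proof -
    have "g \<otimes> f [^] (m * k) \<otimes> inv g = f [^] (n * k)"
      using conjugate_int_pow[OF g, of "f [^] m" k] f_carrier mn(2) by (simp add: int_pow_pow)
    then have "g \<otimes> f [^] (m * k) = f [^] (n * k) \<otimes> g"
      using g f_carrier by (metis inv_solve_right int_pow_closed m_closed)
    then have "y (m * k) = \<phi> (f [^] (n * k)) (\<phi> g p)"
      unfolding y_def using act_orb[OF g] act_mult[of "f [^] (n * k)" g p] g f_carrier p by simp
    then show ?thesis
      using dist_act[of "f [^] (n * k)" "\<phi> g p" p] g f_carrier p
      by (simp add: orb_def C_def act_closed)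
  qed
  obtain k :: nat where k: "(b + 2 * \<delta> + C) / c < k" using reals_Archimedean2 by blast
  have large: "b + 2 * \<delta> < gp (y 0) (y (m * j)) (orb (n * j))" if j: "\<bar>j\<bar> = int k" for j
  proof -
    have "int k \<le> \<bar>0 - m * j\<bar>" using mult_right_mono[of 1 "\<bar>m\<bar>" "int k"] mn(1) j
      by (simp add: abs_mult)
    then have "c * k \<le> c * real_of_int \<bar>0 - m * j\<bar>" using c by (intro mult_left_mono) linarith+
    also have "\<dots> \<le> d (y 0) (y (m * j))" by (rule quasi_lineD(3)[OF y])
    finally have "b + 2 * \<delta> + C < d (y 0) (y (m * j))" using k c by (simp add: field_simps)
    then show ?thesis
      using gromov_product_ge[of "y 0" "y (m * j)" "orb (n * j)"] close[of j] M by simp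
  qed
  show ?thesis
  \<comment> \<open>The sign of \<open>m\<close> decides which of the indices
    \<open>m * int k\<close> and \<open>m * - int k\<close> lies behind \<open>0\<close> on the
    translated quasi-line.\<close>
  proof (cases "0 < m")
    case True
    then have "m * - int k \<le> 0" "0 \<le> m * int k" by auto
    from quasi_lines_close[OF quasi_line_orb y this large large] show ?thesis
      unfolding y0 by (simp add: width_def)
  next
    case False
    then have "m * int k \<le> 0" "0 \<le> m * - int k"
      by (auto simp: mult_nonpos_nonneg)
    from quasi_lines_close[OF quasi_line_orb y this large large] show ?thesis
      unfolding y0 by (simp add: width_def)
  qed
qed

lemma s_normal_imp_elementary:
  assumes sn: "s_normal H G"
  shows "elementary_action G M d \<phi>"
proof -
  define cls where "cls v = boundary_rel M d `` {v}" for v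
  have sub: "limit_set G M d \<phi> \<subseteq> {cls orb_pos, cls orb_neg}"
  proof
    fix \<xi> assume "\<xi> \<in> limit_set G M d \<phi>"
    then obtain q u where q: "q \<in> M" and \<xi>: "\<xi> \<in> gromov_boundary M d" "u \<in> \<xi>"
      and u: "range u \<subseteq> orbit G \<phi> q"
      unfolding limit_set_def accumulation_points_def by blast
    obtain v where v: "v \<in> converging_at_infinity M d" "\<xi> = cls v"
      using \<xi>(1) by (auto simp: gromov_boundary_def cls_def elim!: quotientE)
    then have "(v, u) \<in> boundary_rel M d" using \<xi>(2) by (simp add: cls_def)
    then have uc: "u \<in> converging_at_infinity M d" and \<xi>u: "\<xi> = cls u"
      using equiv_class_eq[OF equiv_boundary_rel] v(2) by (auto simp: boundary_rel_iff cls_def)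
    \<comment> \<open>The limit set ranges over all orbits; passing from the orbit of
      \<open>q\<close> to that of \<open>p\<close> costs \<open>d q p\<close>.\<close>
    have "\<exists>k. d (u i) (orb k) \<le> d q p + width" for i
    proof -
      obtain g where g: "g \<in> carrier G" "u i = \<phi> g q" using u by (auto simp: orbit_def)
      obtain k where k: "d (\<phi> g p) (orb k) \<le> width" using orbit_near_orb[OF sn g(1)] by blast
      have "d (u i) (orb k) \<le> d q p + d (\<phi> g p) (orb k)"
        using triangle[of "\<phi> g q" "\<phi> g p" "orb k"] dist_act[OF g(1) q p] g p q
          quasi_lineD(1)[OF quasi_line_orb] by (simp add: act_closed)
      with k show ?thesis by (intro exI[of _ k]) simp
    qed
    from near_quasi_line_end[OF quasi_line_orb c uc this]
    show "\<xi> \<in> {cls orb_pos, cls orb_neg}"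
      unfolding \<xi>u cls_def using equiv_class_eq[OF equiv_boundary_rel] by blast
  qed
  have "card {cls orb_pos, cls orb_neg} \<le> 2" by (simp add: card_insert_if)
  then have "card (limit_set G M d \<phi>) \<le> 2"
    using card_mono[OF _ sub] by simp
  moreover have "finite (limit_set G M d \<phi>)" using finite_subset[OF sub] by simp
  ultimately show ?thesis by (simp add: elementary_action_def)
qed

end

section \<open>Non-elementarity and acylindricity of the restricted action\<close>

theorem (in hyperbolic_action) s_normal_not_elementary:
  assumes acyl: "acylindrical_action G M d \<phi>" and sn: "s_normal H G"
    and nonel: "\<not> elementary_action G M d \<phi>"
  shows "\<not> elementary_action (G\<lparr>carrier := H\<rparr>) M d \<phi>"
proof
  assume el: "elementary_action (G\<lparr>carrier := H\<rparr>) M d \<phi>"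
  interpret G: group G by (rule is_group)
  have H: "subgroup H G" using sn by (simp add: s_normal_def)
  show False
  proof (cases "nonloxodromic H")
    case True
    \<comment> \<open>This is s-normality for the identity element.\<close>
    have inf: "infinite H"
    proof
      assume "finite H"
      then have "finite {k \<in> H. \<one> \<otimes> k \<otimes> inv \<one> \<in> H}" by simp
      with s_normal_infinite[OF sn G.one_closed] show False by contradiction
    qed
    have "limit_set G M d \<phi> \<noteq> {}" using nonel by (auto simp: elementary_action_def)
    then obtain p where p: "p \<in> M" unfolding limit_set_def by blast
    obtain B where "\<forall>h\<in>H. d p (\<phi> h p) \<le> B"
      using nonloxodromic_bounded[OF H True acyl inf p] by blast
    then obtain R where "\<forall>g\<in>carrier G. d p (\<phi> g p) \<le> R"
      using s_normal_bounded[OF acyl sn p] by blast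
    then have "limit_set G M d \<phi> = {}" using limit_set_bounded[OF p] by blast
    with nonel show False by (simp add: elementary_action_def)
  next
    case False
    then obtain f p where f: "f \<in> H" and p: "p \<in> M"
      and "d p (\<phi> f p) + 4 * \<delta> < d p (\<phi> (f \<otimes> f) p)"
      unfolding nonloxodromic_def by (meson not_le_imp_less)
    then obtain b c L where "0 < c" "quasi_line M d b c L (\<lambda>i::int. \<phi> (f [^] i) p)"
      using quasi_line_orbit subgroup.mem_carrier[OF H f] by blast
    then interpret loxodromic_subgroup M d \<delta> G \<phi> H f p b c L
      using acyl H f p el hyperbolic_action_axioms
      by (simp add: loxodromic_subgroup_def loxodromic_subgroup_axioms_def)
    show False using s_normal_imp_elementary[OF sn] nonel by blast
  qed
qed

lemma acylindrical_action_subgroup: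
  assumes G: "group G" and H: "subgroup H G" and acyl: "acylindrical_action G M d \<phi>"
  shows "acylindrical_action (G\<lparr>carrier := H\<rparr>) M d \<phi>"
proof -
  have sub: "H \<subseteq> carrier G" using subgroup.subset[OF H] .
  have "group_action G M \<phi>"
    using acyl by (simp add: acylindrical_action_def isometric_action_def)
  then have "group_hom G (BijGroup M) \<phi>" by (simp add: group_action_def)
  then have "group_hom (G\<lparr>carrier := H\<rparr>) (BijGroup M) \<phi>"
    using sub subgroup.subgroup_is_group[OF H G]
    by (auto simp: group_hom_def group_hom_axioms_def hom_def)
  then have "isometric_action (G\<lparr>carrier := H\<rparr>) M d \<phi>"
    using acyl sub by (auto simp: acylindrical_action_def isometric_action_def group_action_def)
  moreover have "\<exists>R>0. \<exists>N>(0::nat). \<forall>x\<in>M. \<forall>y\<in>M. d x y \<ge> R \<longrightarrow>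
        finite {g\<in>H. d x (\<phi> g x) \<le> \<epsilon> \<and> d y (\<phi> g y) \<le> \<epsilon>} \<and>
        card {g\<in>H. d x (\<phi> g x) \<le> \<epsilon> \<and> d y (\<phi> g y) \<le> \<epsilon>} \<le> N" if "\<epsilon> > 0" for \<epsilon>
  proof -
    obtain R N where "R > 0" "N > (0::nat)" and RN: "\<forall>x\<in>M. \<forall>y\<in>M. d x y \<ge> R \<longrightarrow>
        finite {g\<in>carrier G. d x (\<phi> g x) \<le> \<epsilon> \<and> d y (\<phi> g y) \<le> \<epsilon>} \<and>
        card {g\<in>carrier G. d x (\<phi> g x) \<le> \<epsilon> \<and> d y (\<phi> g y) \<le> \<epsilon>} \<le> N"
      using acyl \<open>\<epsilon> > 0\<close> unfolding acylindrical_action_def by meson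
    have mono: "{g\<in>H. d x (\<phi> g x) \<le> \<epsilon> \<and> d y (\<phi> g y) \<le> \<epsilon>}
        \<subseteq> {g\<in>carrier G. d x (\<phi> g x) \<le> \<epsilon> \<and> d y (\<phi> g y) \<le> \<epsilon>}" for x y
      using sub by blast
    show ?thesis
      using RN finite_subset[OF mono] card_mono[OF _ mono] \<open>R > 0\<close> \<open>N > 0\<close>
      by (meson order_trans)
  qed
  ultimately show ?thesis by (simp add: acylindrical_action_def)
qed

theorem corollary1p5:
  fixes G :: "('g, 'm) monoid_scheme" and H :: "'g set"
  assumes "acylindrically_hyperbolic TYPE('s) G"
    and "s_normal H G"
  shows "acylindrically_hyperbolic TYPE('s) (G\<lparr>carrier := H\<rparr>)"
proof -
  obtain M :: "'s set" and d \<phi> where G: "group G" and hyp: "hyperbolic_space M d"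
    and acyl: "acylindrical_action G M d \<phi>" and nonel: "\<not> elementary_action G M d \<phi>"
    using assms(1) unfolding acylindrically_hyperbolic_def by blast
  have H: "subgroup H G" using assms(2) by (simp add: s_normal_def)
  obtain \<delta> where "gromov_hyperbolic M d \<delta>"
    using hyperbolic_space_imp_gromov_hyperbolic[OF hyp] .
  then have "hyperbolic_action M d \<delta> G \<phi>"
    using acyl by (simp add: hyperbolic_action_def hyperbolic_action_axioms_def
        acylindrical_action_def)
  then have "\<not> elementary_action (G\<lparr>carrier := H\<rparr>) M d \<phi>"
    using hyperbolic_action.s_normal_not_elementary acyl assms(2) nonel by blast
  then show ?thesis
    unfolding acylindrically_hyperbolic_def
    using hyp acylindrical_action_subgroup[OF G H acyl] subgroup.subgroup_is_group[OF H G]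
    by blast
qed

end
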